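(* Let $n_{2}=n_{2}(n_{1})\geq n_{1}$ and $p=p(n_{1})\in[0,1]$ be functions of $n_{1}\in\mathbb{N}$ such that $$\sqrt{n_{1}p}\,\log^{3}(n_{1})=o(n_{1}p)\quad\text{and}\quad \sqrt{n_{2}p}\,\log^{3}(n_{2})=o(n_{2}p)$$ as $n_{1}\to\infty$. Let $G\sim G(n_{1},n_{2},p)$ and let $A(G)$ be its adjacency matrix. Then there is a sequence $\varepsilon_{n_{1}}\to 0$ such that, with probability tending to $1$ as $n_{1}\to\infty$, $$\mu_{2}(A(G))\leq 2(1+\varepsilon_{n_{1}})\Big(\sqrt{(n_{1}+n_{2})p}+\sqrt{n_{1}p}+\sqrt{n_{2}p}\Big).$$ Moreover, there is a sequence $\varepsilon'_{n_{1}}\to 0$ such that, with probability tending to $1$ as $n_{1}\to\infty$, $$\max_{i\neq 1,\,n_{1}+n_{2}}\big|\mu_{i}(G)-1\big|\leq 2(1+\varepsilon'_{n_{1}})\Big(\sqrt{\tfrac{1}{n_{1}p}+\tfrac{1}{n_{2}p}}+\tfrac{1}{\sqrt{n_{1}p}}+\tfrac{1}{\sqrt{n_{2}p}}\Big).$$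
   Context: For $f,g:\mathbb{N}\to\mathbb{R}_{+}$, $f=o(g)$ means $f(n)/g(n)\to 0$ as $n\to\infty$. The Erdős–Rényi random bipartite graph $G(n_{1},n_{2},p)$ (with $n_{2}\geq n_{1}$) is the random graph with vertex set $V_{1}\sqcup V_{2}$, $V_{1}=\{u_{1},\dots,u_{n_{1}}\}$, $V_{2}=\{v_{1},\dots,v_{n_{2}}\}$, in which each edge $(u_{i},v_{j})$ is present independently with probability $p$, and there are no other edges. For a symmetric real $n\times n$ matrix $M$, its eigenvalues are ordered $\mu_{1}(M)\geq\mu_{2}(M)\geq\dots\geq\mu_{n}(M)$. For a graph $G$ on $n$ vertices with adjacency matrix $A=A(G)$ and diagonal degree matrix $D=D(G)$ (entries the vertex degrees; assumed to have no isolated vertices so $D^{-1/2}$ is defined), $\mu_{i}(G):=\mu_{i}(I-D^{-1/2}AD^{-1/2})$ for $i=1,\dots,n$. *)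

theory Defs
  imports
    "HOL-Probability.Probability"
    "HOL-Probability.Product_PMF"
    "Jordan_Normal_Form.Char_Poly"
begin

text \<open>
  The functions compared by \<open>f = o(g)\<close> take values in \<open>\<real>\<^sub>+\<close>, so that
  \<open>f n / g n\<close> makes sense; the positivity of \<open>g\<close> is needed only for large \<open>n\<close>, and is
  stated explicitly because division by zero yields zero in HOL.
\<close>
definition little_o :: "(nat \<Rightarrow> real) \<Rightarrow> (nat \<Rightarrow> real) \<Rightarrow> bool" where
  "little_o f g \<longleftrightarrow>
     (\<forall>\<^sub>F n in sequentially. g n > 0) \<and> (\<lambda>n. f n / g n) \<longlonglongrightarrow> 0"

text \<open>
  \<open>mu i M\<close> is the \<open>i\<close>-th largest eigenvalue (\<open>1 \<le> i \<le> n\<close>) of a real symmetric \<open>n \<times> n\<close> matrix: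
  for such a matrix the characteristic polynomial splits over the reals, so the list below
  has length \<open>n\<close> and contains every eigenvalue with its multiplicity.
\<close>
definition mu :: "nat \<Rightarrow> real mat \<Rightarrow> real" where
  "mu i M = rev (sorted_list_of_multiset (proots (char_poly M))) ! (i - 1)"

text \<open>
  A graph on the vertex set \<open>{0..<n}\<close> is given by \<open>n\<close> and its set of edges, each edge being the
  set of its two endpoints.
\<close>
definition adjacency_matrix :: "nat \<Rightarrow> nat set set \<Rightarrow> real mat" where
  "adjacency_matrix n E = Matrix.mat n n (\<lambda>(i, j). if {i, j} \<in> E then 1 else 0)"

definition vertex_degree :: "nat set set \<Rightarrow> nat \<Rightarrow> nat" where
  "vertex_degree E v = card {e \<in> E. v \<in> e}"

text \<open>
  The matrix \<open>D\<^sup>-\<^sup>1\<^sup>/\<^sup>2\<close>. An isolated vertex, for which the entry is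
  mathematically undefined, gets the entry \<open>1 / sqrt 0 = 0\<close>. It then contributes an eigenvalue
  1 to \<open>I - D\<^sup>-\<^sup>1\<^sup>/\<^sup>2 A D\<^sup>-\<^sup>1\<^sup>/\<^sup>2\<close>.
\<close>
definition inv_sqrt_degree_matrix :: "nat \<Rightarrow> nat set set \<Rightarrow> real mat" where
  "inv_sqrt_degree_matrix n E = mat_diag n (\<lambda>v. 1 / sqrt (real (vertex_degree E v)))"

definition normalized_laplacian :: "nat \<Rightarrow> nat set set \<Rightarrow> real mat" where
  "normalized_laplacian n E =
     1\<^sub>m n - inv_sqrt_degree_matrix n E * adjacency_matrix n E * inv_sqrt_degree_matrix n E"

definition mu_graph :: "nat \<Rightarrow> nat \<Rightarrow> nat set set \<Rightarrow> real" where
  "mu_graph i n E = mu i (normalized_laplacian n E)"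

text \<open>
  The distribution of the edge set of \<open>G(n\<^sub>1, n\<^sub>2, p)\<close>. The vertices
  \<open>u\<^sub>1, \<dots>\<close> of \<open>V\<^sub>1\<close> are \<open>0, \<dots>, n1 - 1\<close>, and the vertices \<open>v\<^sub>1, \<dots>\<close> of \<open>V\<^sub>2\<close> are
  \<open>n1, \<dots>, n1 + n2 - 1\<close>.
\<close>
definition random_bipartite :: "nat \<Rightarrow> nat \<Rightarrow> real \<Rightarrow> nat set set pmf" where
  "random_bipartite n1 n2 p =
     map_pmf (\<lambda>X. {{i, n1 + j} | i j. i < n1 \<and> j < n2 \<and> X (i, j)})
       (Pi_pmf ({..<n1} \<times> {..<n2}) False (\<lambda>_. bernoulli_pmf p))"

end

theory Submission
  imports Defs "Jordan_Normal_Form.Schur_Decomposition"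
begin

text \<open>
  Both bounds hold with \<open>\<epsilon> = \<epsilon>' = 0\<close>, because their right-hand sides exceed the true order of
  magnitude by a constant factor. Let \<open>X\<close> be the centred adjacency matrix.
  The expected trace of \<open>X ^ (2 * k)\<close> with \<open>k\<close> of order \<open>log n2\<close> is a sum over closed walks in which
  every edge is traversed at least twice. Revealing a walk step by step and controlling it by a
  potential function shows that each step contributes a factor of at most
  \<open>2 * sqrt (n2 * p) + O(k\<^sup>2)\<close>, so \<open>\<parallel>X\<parallel> \<le> 3 * sqrt (n2 * p)\<close> with high probability.
  The expectation of the adjacency matrix is a rank-two form \<open>2 (a \<bullet> x) (b \<bullet> x)\<close>, which can only
  move one eigenvalue above and one eigenvalue below the interval given by \<open>\<parallel>X\<parallel>\<close>; this gives the
  first bound.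

  For the normalized Laplacian, if \<open>n2 \<le> n1 ^ 3\<close> then all degrees are concentrated and the same
  argument applies after rescaling. If \<open>n2 \<ge> n1 ^ 3\<close>, the degrees in \<open>V\<^sub>2\<close> need not be concentrated
  (there may even be isolated vertices). In that case the two-step walk matrix on \<open>V\<^sub>1\<close> is a sum of
  \<open>n2\<close> independent exchangeable matrices, and the second moment of its Frobenius distance to the
  mean is small enough.
\<close>

unbundle no inner_syntax and no vec_syntax

section \<open>Symmetric matrices\<close>

lemma symmetric_eigenvalue_real:
  fixes A :: "real mat" and c :: complex
  assumes A: "A \<in> carrier_mat n n" and sym: "A\<^sup>T = A"
    and ev: "eigenvalue (map_mat complex_of_real A) c"
  shows "c \<in> \<real>"
proof -
  let ?A = "map_mat complex_of_real A"
  have A': "?A \<in> carrier_mat n n" using A by simp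
  obtain v where v: "v \<in> carrier_vec n" "v \<noteq> 0\<^sub>v n" and Av: "?A *\<^sub>v v = c \<cdot>\<^sub>v v"
    using ev A unfolding eigenvalue_def eigenvector_def by auto
  have sym': "?A\<^sup>T = ?A"
    using sym A by (metis map_mat_transpose)
  have conj: "conjugate (?A *\<^sub>v v) = ?A *\<^sub>v conjugate v"
    using A v(1) by (intro eq_vecI) (auto simp: scalar_prod_def sum_conjugate conjugate_dist_mul)
  have "c * (v \<bullet>c v) = (?A\<^sup>T *\<^sub>v v) \<bullet> conjugate v"
    using v Av by (simp add: sym')
  also have "\<dots> = v \<bullet> (?A *\<^sub>v conjugate v)"
    using v by (intro transpose_vec_mult_scalar[OF A']) auto
  also have "\<dots> = v \<bullet>c (c \<cdot>\<^sub>v v)"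
    using conj Av by simp
  also have "\<dots> = cnj c * (v \<bullet>c v)"
    using v by (simp add: conjugate_smult_vec)
  finally have "c = cnj c"
    using v by auto
  thus ?thesis by (metis Reals_cnj_iff)
qed

lemma symmetric_unit_eigenvector:
  fixes A :: "real mat"
  assumes A: "A \<in> carrier_mat n n" and sym: "A\<^sup>T = A" and n: "n > 0"
  obtains v c where "v \<in> carrier_vec n" "v \<bullet> v = 1" "A *\<^sub>v v = c \<cdot>\<^sub>v v"
proof -
  let ?A = "map_mat complex_of_real A"
  have A': "?A \<in> carrier_mat n n" using A by simp
  have "\<not> constant (poly (char_poly ?A))"
    using degree_monic_char_poly[OF A'] n by (simp add: constant_degree)
  then obtain z where z: "poly (char_poly ?A) z = 0"
    using fundamental_theorem_of_algebra by blast
  hence "z \<in> \<real>"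
    using eigenvalue_root_char_poly[OF A'] symmetric_eigenvalue_real[OF A sym] by simp
  then obtain c where c: "z = complex_of_real c" by (rule Reals_cases)
  have "complex_of_real (poly (char_poly A) c) = 0"
    using z unfolding c of_real_hom.char_poly_hom[OF A] by simp
  hence "eigenvalue A c" using eigenvalue_root_char_poly[OF A] by simp
  then obtain u where u: "u \<in> carrier_vec n" "u \<noteq> 0\<^sub>v n" "A *\<^sub>v u = c \<cdot>\<^sub>v u"
    using A unfolding eigenvalue_def eigenvector_def by auto
  have pos: "u \<bullet> u > 0" using u conjugate_square_greater_0_vec[of u n] by simp
  define v where "v = (1 / sqrt (u \<bullet> u)) \<cdot>\<^sub>v u"
  show ?thesis
  proof
    show "v \<in> carrier_vec n" using u by (simp add: v_def)
    show "v \<bullet> v = 1" using u pos by (simp add: v_def)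
    show "A *\<^sub>v v = c \<cdot>\<^sub>v v"
      using A u by (simp add: v_def mult_mat_vec smult_smult_assoc mult.commute)
  qed
qed

text \<open>The Householder reflection that exchanges \<open>v\<close> and the first unit vector. If these two vectors
  agree, then the quotient \<open>c\<close> below is \<open>2 / 0 = 0\<close>, and the reflection is the identity.\<close>
lemma orthogonal_involution_first_col:
  fixes v :: "real vec"
  assumes v: "v \<in> carrier_vec n" and unit: "v \<bullet> v = 1" and n: "n > 0"
  obtains W where "W \<in> carrier_mat n n" "W\<^sup>T = W" "W * W = 1\<^sub>m n" "col W 0 = v"
proof -
  define u where "u i = v $ i - of_bool (i = 0)" for i
  define s where "s = (\<Sum>i<n. (u i)\<^sup>2)"
  define c where "c = 2 / s"
  define W where "W = Matrix.mat n n (\<lambda>(i, j). of_bool (i = j) - c * u i * u j)"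
  have W: "W \<in> carrier_mat n n" by (simp add: W_def)
  have cs: "c * (c * s) = 2 * c" by (simp add: c_def)
  have "s = (\<Sum>i<n. (v $ i)\<^sup>2 - 2 * (of_bool (i = 0) * v $ i) + of_bool (i = 0))"
    unfolding s_def by (intro sum.cong) (auto simp: u_def power2_eq_square algebra_simps)
  also have "\<dots> = v \<bullet> v - 2 * v $ 0 + 1"
    using v n
    by (simp add: sum.distrib sum_subtractf scalar_prod_def power2_eq_square atLeast0LessThan
        of_bool_def if_distrib[of "\<lambda>x. x * _"] flip: sum_distrib_left cong: if_cong)
  finally have s: "s = - 2 * u 0" by (simp add: unit u_def)
  have cu: "c * u i * u 0 = - u i" if "i < n" for i
  proof (cases "s = 0")
    case True
    hence "u i = 0" using that by (simp add: s_def sum_nonneg_eq_0_iff)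
    thus ?thesis by simp
  next
    case False
    thus ?thesis using s by (simp add: c_def field_simps)
  qed
  have "(W * W) $$ (i, j) = 1\<^sub>m n $$ (i, j)" if ij: "i < n" "j < n" for i j
  proof -
    have "(W * W) $$ (i, j)
      = (\<Sum>k<n. (of_bool (i = k) - c * u i * u k) * (of_bool (k = j) - c * u k * u j))"
      using ij by (simp add: W_def scalar_prod_def atLeast0LessThan)
    also have "\<dots> = (\<Sum>k<n. (if k = i then of_bool (i = j) - c * u i * u j else 0)
        - (if k = j then c * u i * u j else 0) + c * c * (u i * u j) * (u k)\<^sup>2)"
      by (intro sum.cong refl) (simp add: power2_eq_square algebra_simps)
    also have "\<dots> = of_bool (i = j) - 2 * c * (u i * u j) + c * (c * s) * (u i * u j)"
      using ij by (simp add: sum.distrib sum_subtractf s_def flip: sum_distrib_left)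
    also have "\<dots> = 1\<^sub>m n $$ (i, j)" using ij cs by simp
    finally show ?thesis .
  qed
  hence "W * W = 1\<^sub>m n" using W by (intro eq_matI) auto
  moreover have "W\<^sup>T = W" unfolding W_def by (intro eq_matI) auto
  moreover have "col W 0 = v"
    using v n by (intro eq_vecI) (simp_all add: W_def cu, simp add: u_def)
  ultimately show ?thesis using that W by blast
qed

lemma similar_mat_wit_orthogonal_trans:
  fixes A :: "real mat"
  assumes A: "A \<in> carrier_mat n n" and U: "similar_mat_wit A B U U\<^sup>T"
    and V: "similar_mat_wit B C V V\<^sup>T"
  shows "similar_mat_wit A C (U * V) (U * V)\<^sup>T"
proof -
  have "U \<in> carrier_mat n n" "V \<in> carrier_mat n n"
    using similar_mat_witD2[OF A U] similar_mat_witD2[OF _ V] by auto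
  hence "(U * V)\<^sup>T = V\<^sup>T * U\<^sup>T" by (rule transpose_mult)
  thus ?thesis using similar_mat_wit_trans[OF U V] by simp
qed

lemma symmetric_deflation:
  fixes A :: "real mat"
  assumes A: "A \<in> carrier_mat (Suc n) (Suc n)" and sym: "A\<^sup>T = A"
  obtains W c C where "C \<in> carrier_mat n n" "C\<^sup>T = C"
    "similar_mat_wit A (four_block_mat (Matrix.mat 1 1 (\<lambda>_. c)) (0\<^sub>m 1 n) (0\<^sub>m n 1) C) W W\<^sup>T"
proof -
  let ?n = "Suc n"
  obtain v c where v: "v \<in> carrier_vec ?n" "v \<bullet> v = 1" and Av: "A *\<^sub>v v = c \<cdot>\<^sub>v v"
    by (rule symmetric_unit_eigenvector[OF A sym]) auto
  obtain W where W: "W \<in> carrier_mat ?n ?n" "W\<^sup>T = W" "W * W = 1\<^sub>m ?n" "col W 0 = v"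
    by (rule orthogonal_involution_first_col[OF v]) auto
  define B where "B = W * A * W"
  have B: "B \<in> carrier_mat ?n ?n" using W A by (simp add: B_def)
  have "W * B * W = (W * W) * A * (W * W)"
    unfolding B_def using W(1) A by (simp add: assoc_mult_mat[of _ ?n ?n _ ?n _ ?n])
  hence wit: "similar_mat_wit A B W W\<^sup>T"
    using W(1,3) B A unfolding W(2) by (intro similar_mat_witI[of _ _ ?n]) auto
  have "B\<^sup>T = B"
    using W A sym
    by (simp add: B_def transpose_mult[of _ ?n ?n _ ?n] assoc_mult_mat[of _ ?n ?n _ ?n _ ?n])
  hence symB: "B $$ (i, j) = B $$ (j, i)" if "i < ?n" "j < ?n" for i j
    using that B by (metis carrier_matD index_transpose_mat(1))
  have "col B 0 = col (W * (A * W)) 0"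
    unfolding B_def using W(1) A by (simp add: assoc_mult_mat[of _ ?n ?n _ ?n _ ?n])
  also have "\<dots> = W *\<^sub>v (A *\<^sub>v col W 0)"
    using col_mult2[of W ?n ?n "A * W" ?n 0] col_mult2[of A ?n ?n W ?n 0] W(1) A by simp
  also have "\<dots> = c \<cdot>\<^sub>v (W *\<^sub>v col W 0)"
    unfolding W(4) Av using W(1) v(1) by (rule mult_mat_vec)
  also have "W *\<^sub>v col W 0 = col (W * W) 0"
    using W(1) by (intro col_mult2[symmetric]) auto
  finally have first_col: "col B 0 = c \<cdot>\<^sub>v unit_vec ?n 0" by (simp add: W(3))
  have col0: "B $$ (i, 0) = (if i = 0 then c else 0)" if "i < ?n" for i
    using arg_cong[OF first_col, of "\<lambda>w. w $ i"] that B by (simp add: unit_vec_def)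
  have row0: "B $$ (0, i) = (if i = 0 then c else 0)" if "i < ?n" for i
    using symB[of 0 i] col0[OF that] that by simp
  define C where "C = Matrix.mat n n (\<lambda>(i, j). B $$ (Suc i, Suc j))"
  have C: "C \<in> carrier_mat n n" "C\<^sup>T = C"
    unfolding C_def using symB by (auto intro!: eq_matI)
  have block: "B = four_block_mat (Matrix.mat 1 1 (\<lambda>_. c)) (0\<^sub>m 1 n) (0\<^sub>m n 1) C"
    using B col0 row0 by (intro eq_matI) (auto simp: C_def)
  show ?thesis by (rule that[OF C wit[unfolded block]])
qed

lemma similar_mat_wit_four_block_diag:
  fixes C :: "real mat"
  assumes C: "C \<in> carrier_mat n n" and wit: "similar_mat_wit C (mat_diag n d) V V\<^sup>T"
  defines "V' \<equiv> four_block_mat (1\<^sub>m 1) (0\<^sub>m 1 n) (0\<^sub>m n 1) V"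
  shows "similar_mat_wit (four_block_mat (Matrix.mat 1 1 (\<lambda>_. c)) (0\<^sub>m 1 n) (0\<^sub>m n 1) C)
    (mat_diag (Suc n) (case_nat c d)) V' V'\<^sup>T"
proof -
  let ?c = "Matrix.mat 1 1 (\<lambda>_. c)"
  have V: "V \<in> carrier_mat n n" using similar_mat_witD2[OF C wit] by blast
  have "mat_diag (Suc n) (case_nat c d) = four_block_mat ?c (0\<^sub>m 1 n) (0\<^sub>m n 1) (mat_diag n d)"
    by (intro eq_matI) (auto simp: mat_diag_def split: nat.splits)
  moreover have "V'\<^sup>T = four_block_mat (1\<^sub>m 1) (0\<^sub>m 1 n) (0\<^sub>m n 1) V\<^sup>T"
    unfolding V'_def using V by (subst transpose_four_block_mat[of _ 1 1 _ n _ n]) auto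
  moreover have "similar_mat_wit (four_block_mat ?c (0\<^sub>m 1 n) (0\<^sub>m n 1) C)
      (four_block_mat ?c (0\<^sub>m 1 n) (0\<^sub>m n 1) (mat_diag n d))
      V' (four_block_mat (1\<^sub>m 1) (0\<^sub>m 1 n) (0\<^sub>m n 1) V\<^sup>T)"
    unfolding V'_def using C V
    by (intro similar_mat_wit_four_block[OF similar_mat_wit_refl[of _ 1] wit]) auto
  ultimately show ?thesis by simp
qed

lemma symmetric_diagonalization:
  fixes A :: "real mat"
  assumes "A \<in> carrier_mat n n" "A\<^sup>T = A"
  shows "\<exists>U d. similar_mat_wit A (mat_diag n d) U U\<^sup>T"
  using assms
proof (induction n arbitrary: A)
  case 0
  hence "similar_mat_wit A (mat_diag 0 d) (1\<^sub>m 0) (1\<^sub>m 0)\<^sup>T" for d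
    by (intro similar_mat_witI[of _ _ 0]) (auto simp: mat_diag_def)
  thus ?case by blast
next
  case (Suc n)
  obtain W c C where C: "C \<in> carrier_mat n n" "C\<^sup>T = C"
    and deflation:
      "similar_mat_wit A (four_block_mat (Matrix.mat 1 1 (\<lambda>_. c)) (0\<^sub>m 1 n) (0\<^sub>m n 1) C) W W\<^sup>T"
    by (rule symmetric_deflation[OF Suc.prems])
  obtain V d where "similar_mat_wit C (mat_diag n d) V V\<^sup>T"
    using Suc.IH[OF C] by blast
  from similar_mat_wit_orthogonal_trans[OF Suc.prems(1) deflation
      similar_mat_wit_four_block_diag[OF C(1) this]]
  show ?case by blast
qed

lemma mu_diagonalization:
  fixes A :: "real mat"
  assumes A: "A \<in> carrier_mat n n" and wit: "similar_mat_wit A (mat_diag n d) U V"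
  obtains \<pi> where "\<pi> permutes {..<n}" "\<And>i. i < n \<Longrightarrow> mu (Suc i) A = d (\<pi> i)"
    "\<And>i j. i \<le> j \<Longrightarrow> j < n \<Longrightarrow> d (\<pi> j) \<le> d (\<pi> i)"
proof -
  let ?ds = "map d [0..<n]"
  define es where "es = rev (sorted_list_of_multiset (proots (char_poly A)))"
  have "char_poly A = char_poly (mat_diag n d)"
    using wit by (intro char_poly_similar) (auto simp: similar_mat_def)
  also have "\<dots> = (\<Prod>a\<leftarrow>diag_mat (mat_diag n d). [:- a, 1:])"
    by (intro char_poly_upper_triangular[of _ n]) (auto simp: mat_diag_def)
  also have "diag_mat (mat_diag n d) = ?ds"
    by (simp add: diag_mat_def mat_diag_def)
  finally have "proots (char_poly A) = (\<Sum>p\<leftarrow>map (\<lambda>a. [:- a, 1:]) ?ds. proots p)"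
    using proots_prod_list[of "map (\<lambda>a. [:- a, 1:]) ?ds"] by (auto simp: image_iff)
  also have "\<dots> = mset ?ds" by (induction n) auto
  finally have mset: "mset es = mset ?ds" by (simp add: es_def)
  then obtain \<pi> where \<pi>: "\<pi> permutes {..<n}" "permute_list \<pi> ?ds = es"
    by (rule mset_eq_permutation) auto
  have nth: "es ! i = d (\<pi> i)" if "i < n" for i
    using \<pi>(1) permutes_in_image[OF \<pi>(1), of i] that
    unfolding \<pi>(2)[symmetric] by (subst permute_list_nth) auto
  show ?thesis
  proof
    show "mu (Suc i) A = d (\<pi> i)" if "i < n" for i
      using nth[OF that] by (simp add: mu_def es_def)
    fix i j assume ij: "i \<le> j" "j < n"
    have "length es = n" using mset by (metis diff_zero length_map length_upt size_mset)
    hence "es ! j \<le> es ! i"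
      using ij unfolding es_def by (intro sorted_rev_nth_mono) auto
    thus "d (\<pi> j) \<le> d (\<pi> i)" using nth ij by simp
  qed (rule \<pi>(1))
qed

definition bilinear_form :: "real mat \<Rightarrow> (nat \<Rightarrow> real) \<Rightarrow> (nat \<Rightarrow> real) \<Rightarrow> real" where
  "bilinear_form A x y = (\<Sum>i<dim_row A. \<Sum>j<dim_col A. A $$ (i, j) * x i * y j)"

abbreviation quad_form :: "real mat \<Rightarrow> (nat \<Rightarrow> real) \<Rightarrow> real" where
  "quad_form A x \<equiv> bilinear_form A x x"

lemma quad_form_vec:
  assumes "A \<in> carrier_mat n n" "x \<in> carrier_vec n"
  shows "quad_form A (\<lambda>i. x $ i) = x \<bullet> (A *\<^sub>v x)"
  using assms unfolding bilinear_form_def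
  by (auto simp: scalar_prod_def atLeast0LessThan sum_distrib_left mult_ac intro!: sum.cong)

lemma quad_form_diagonalization:
  fixes A :: "real mat"
  assumes A: "A \<in> carrier_mat n n" and wit: "similar_mat_wit A (mat_diag n d) U U\<^sup>T"
    and y: "y \<in> carrier_vec n"
  shows "quad_form A (\<lambda>i. (U *\<^sub>v y) $ i) = (\<Sum>j<n. d j * (y $ j)\<^sup>2)"
    and "(\<Sum>i<n. ((U *\<^sub>v y) $ i)\<^sup>2) = (\<Sum>j<n. (y $ j)\<^sup>2)"
proof -
  let ?D = "mat_diag n d"
  note U = similar_mat_witD2[OF A wit]
  have isometry: "(U *\<^sub>v y) \<bullet> (U *\<^sub>v z) = y \<bullet> z" if "z \<in> carrier_vec n" for z
  proof -
    have "y \<bullet> z = y \<bullet> (U\<^sup>T *\<^sub>v (U *\<^sub>v z))"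
      using U that by (simp flip: assoc_mult_mat_vec[of _ n n _ n])
    also have "\<dots> = ((U\<^sup>T)\<^sup>T *\<^sub>v y) \<bullet> (U *\<^sub>v z)"
      using U y that by (intro transpose_vec_mult_scalar[of _ n n, symmetric]) auto
    finally show ?thesis by simp
  qed
  have "A *\<^sub>v (U *\<^sub>v y) = U *\<^sub>v (?D *\<^sub>v (U\<^sup>T * U *\<^sub>v y))"
    unfolding U(3) using U(4-7) y by (simp add: assoc_mult_mat_vec[of _ n n _ n])
  also have "\<dots> = U *\<^sub>v (?D *\<^sub>v y)" using U y by simp
  finally have "quad_form A (\<lambda>i. (U *\<^sub>v y) $ i) = y \<bullet> (?D *\<^sub>v y)"
    using U y A by (subst quad_form_vec[of _ n]) (auto intro!: isometry mult_mat_vec_carrier)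
  also have "\<dots> = quad_form ?D (\<lambda>i. y $ i)"
    using y by (intro quad_form_vec[symmetric]) auto
  also have "\<dots> = (\<Sum>j<n. d j * (y $ j)\<^sup>2)"
    by (simp add: bilinear_form_def mat_diag_def power2_eq_square mult.assoc
        if_distrib[of "\<lambda>t. t * _"] cong: if_cong)
  finally show "quad_form A (\<lambda>i. (U *\<^sub>v y) $ i) = (\<Sum>j<n. d j * (y $ j)\<^sup>2)" .
  have "(\<Sum>i<n. (z $ i)\<^sup>2) = z \<bullet> z" if "z \<in> carrier_vec n" for z :: "real vec"
    using that by (simp add: scalar_prod_def power2_eq_square atLeast0LessThan)
  thus "(\<Sum>i<n. ((U *\<^sub>v y) $ i)\<^sup>2) = (\<Sum>j<n. (y $ j)\<^sup>2)"
    using isometry[OF y] mult_mat_vec_carrier[OF U(6) y] y by presburger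
qed

text \<open>The span of two eigenvectors meets the hyperplane \<open>a \<bullet> x = - b \<bullet> x\<close>, on which the
  rank-two term is nonpositive.\<close>
lemma diagonalization_le_of_quad_form_le:
  fixes A :: "real mat"
  assumes A: "A \<in> carrier_mat n n" and wit: "similar_mat_wit A (mat_diag n d) U U\<^sup>T"
    and ij: "i < n" "j < n" "i \<noteq> j" "d i \<le> d j"
    and qf: "\<And>x. quad_form A x \<le> t * (\<Sum>k<n. (x k)\<^sup>2) + 2 * (\<Sum>k<n. a k * x k) * (\<Sum>k<n. b k * x k)"
  shows "d i \<le> t"
proof -
  define w where "w k = (\<Sum>h<n. (a h + b h) * U $$ (h, k))" for k
  obtain \<alpha> \<gamma> where \<alpha>\<gamma>: "\<alpha> * w i + \<gamma> * w j = 0" "\<alpha> \<noteq> 0 \<or> \<gamma> \<noteq> 0"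
  proof (cases "w i = 0")
    case True thus ?thesis using that[of 1 0] by simp
  next
    case False thus ?thesis using that[of "- w j" "w i"] by simp
  qed
  define y where "y = Matrix.vec n (\<lambda>k. if k = i then \<alpha> else if k = j then \<gamma> else 0)"
  define x where "x k = (U *\<^sub>v y) $ k" for k
  have y: "y \<in> carrier_vec n" by (simp add: y_def)
  have sum_y: "(\<Sum>k<n. g k (y $ k)) = g i \<alpha> + g j \<gamma>" if "\<And>k. g k 0 = 0" for g :: "nat \<Rightarrow> real \<Rightarrow> real"
  proof -
    have "(\<Sum>k<n. g k (y $ k)) = (\<Sum>k\<in>{i, j}. g k (y $ k))"
      using ij that by (intro sum.mono_neutral_right) (auto simp: y_def)
    thus ?thesis using ij by (simp add: y_def)
  qed
  have U: "U \<in> carrier_mat n n" using similar_mat_witD2[OF A wit] by blast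
  have "(\<Sum>h<n. a h * x h) + (\<Sum>h<n. b h * x h) = (\<Sum>h<n. (a h + b h) * (\<Sum>k<n. U $$ (h, k) * y $ k))"
    using U y by (simp add: x_def scalar_prod_def atLeast0LessThan distrib_right sum.distrib)
  also have "\<dots> = (\<Sum>k<n. w k * y $ k)"
    unfolding w_def sum_distrib_left sum_distrib_right by (subst sum.swap) (simp add: mult_ac)
  also have "\<dots> = 0" using \<alpha>\<gamma>(1) by (subst sum_y) (auto simp: mult.commute)
  finally have hyperplane: "(\<Sum>h<n. b h * x h) = - (\<Sum>h<n. a h * x h)" by simp
  have norm: "(\<Sum>k<n. (x k)\<^sup>2) = \<alpha>\<^sup>2 + \<gamma>\<^sup>2"
    unfolding x_def quad_form_diagonalization(2)[OF A wit y] by (rule sum_y) simp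
  have "d i * (\<alpha>\<^sup>2 + \<gamma>\<^sup>2) \<le> d i * \<alpha>\<^sup>2 + d j * \<gamma>\<^sup>2"
    using ij(4) by (simp add: distrib_left mult_right_mono)
  also have "\<dots> = quad_form A x"
    unfolding x_def quad_form_diagonalization(1)[OF A wit y] by (rule sum_y[symmetric]) simp
  also have "\<dots> \<le> t * (\<Sum>k<n. (x k)\<^sup>2) + 2 * (\<Sum>k<n. a k * x k) * (\<Sum>k<n. b k * x k)"
    by (rule qf)
  also have "\<dots> \<le> t * (\<alpha>\<^sup>2 + \<gamma>\<^sup>2)"
    unfolding hyperplane norm by simp
  finally show ?thesis
    using \<alpha>\<gamma>(2) by (auto simp: mult_le_cancel_right add_pos_nonneg add_nonneg_pos not_less)
qed

lemma bilinear_form_uminus [simp]: "bilinear_form (- A) x y = - bilinear_form A x y"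
  by (simp add: bilinear_form_def sum_negf)

lemma similar_mat_wit_uminus_diag:
  fixes A :: "real mat"
  assumes A: "A \<in> carrier_mat n n" and wit: "similar_mat_wit A (mat_diag n d) U V"
  shows "similar_mat_wit (- A) (mat_diag n (\<lambda>i. - d i)) U V"
proof -
  note U = similar_mat_witD2[OF A wit]
  have diag: "mat_diag n (\<lambda>i. - d i) = - mat_diag n d"
    by (intro eq_matI) (auto simp: mat_diag_def)
  have uminus: "- A = U * (- mat_diag n d) * V"
    unfolding U(3) using U(6,7) by (simp add: carrier_matD[OF mat_diag_dim])
  show ?thesis
    unfolding diag by (rule similar_mat_witI[OF U(1,2) uminus _ _ U(6,7)]) (use U(4,5) in auto)
qed

lemma mu_near:
  fixes M :: "real mat"
  assumes M: "M \<in> carrier_mat n n" and sym: "M\<^sup>T = M" and k: "1 < k" "k < n"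
    and qf: "\<And>x. \<bar>quad_form M x - s * (\<Sum>i<n. (x i)\<^sup>2) - 2 * (\<Sum>i<n. a i * x i) * (\<Sum>i<n. b i * x i)\<bar>
              \<le> \<beta> * (\<Sum>i<n. (x i)\<^sup>2)"
  shows "\<bar>mu k M - s\<bar> \<le> \<beta>"
proof -
  obtain U d where wit: "similar_mat_wit M (mat_diag n d) U U\<^sup>T"
    using symmetric_diagonalization[OF M sym] by blast
  obtain \<pi> where \<pi>: "\<pi> permutes {..<n}" and mu: "\<And>i. i < n \<Longrightarrow> mu (Suc i) M = d (\<pi> i)"
    and mono: "\<And>i j. i \<le> j \<Longrightarrow> j < n \<Longrightarrow> d (\<pi> j) \<le> d (\<pi> i)"
    by (rule mu_diagonalization[OF M wit]) blast
  have \<pi>_less: "\<pi> i < n" if "i < n" for i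
    using permutes_in_image[OF \<pi>, of i] that by simp
  have \<pi>_neq: "\<pi> i \<noteq> \<pi> j" if "i \<noteq> j" for i j
    using permutes_inj[OF \<pi>] that by (auto dest: injD)
  have "d (\<pi> (k - 1)) \<le> s + \<beta>"
  proof (rule diagonalization_le_of_quad_form_le[OF M wit, of _ "\<pi> 0"])
    show "quad_form M x \<le> (s + \<beta>) * (\<Sum>i<n. (x i)\<^sup>2) + 2 * (\<Sum>i<n. a i * x i) * (\<Sum>i<n. b i * x i)"
      for x
      using qf[of x] by (simp add: algebra_simps)
  qed (use k mono \<pi>_less \<pi>_neq in auto)
  moreover have "- d (\<pi> (k - 1)) \<le> \<beta> - s"
  proof (rule diagonalization_le_of_quad_form_le[OF _
        similar_mat_wit_uminus_diag[OF M wit], of _ "\<pi> (n - 1)"])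
    show "quad_form (- M) x
      \<le> (\<beta> - s) * (\<Sum>i<n. (x i)\<^sup>2) + 2 * (\<Sum>i<n. - a i * x i) * (\<Sum>i<n. b i * x i)" for x
      using qf[of x] by (simp add: algebra_simps sum_negf)
  qed (use M k mono \<pi>_less \<pi>_neq in auto)
  moreover have "mu k M = d (\<pi> (k - 1))" using mu[of "k - 1"] k by simp
  ultimately show ?thesis by linarith
qed

lemma pow_mat_diag: "mat_diag n d ^\<^sub>m k = mat_diag n (\<lambda>i. d i ^ k)" for d :: "nat \<Rightarrow> real"
  by (induction k) (simp_all add: carrier_matD(1)[OF mat_diag_dim] mult.commute)

lemma trace_pow_diagonalization:
  fixes A :: "real mat"
  assumes A: "A \<in> carrier_mat n n" and wit: "similar_mat_wit A (mat_diag n d) U U\<^sup>T"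
  shows "(\<Sum>i<n. (A ^\<^sub>m k) $$ (i, i)) = (\<Sum>j<n. d j ^ k)"
proof -
  note U = similar_mat_witD2[OF A wit]
  have "(A ^\<^sub>m k) $$ (i, i) = (\<Sum>j<n. d j ^ k * (U $$ (i, j))\<^sup>2)" if "i < n" for i
    using U(4-7) that
    unfolding similar_mat_wit_pow_id[OF wit] pow_mat_diag mat_diag_mult_right[OF U(6)]
    by (simp add: scalar_prod_def atLeast0LessThan power2_eq_square mult_ac)
  hence "(\<Sum>i<n. (A ^\<^sub>m k) $$ (i, i)) = (\<Sum>j<n. d j ^ k * (\<Sum>i<n. (U $$ (i, j))\<^sup>2))"
    by (simp add: sum_distrib_left) (rule sum.swap)
  also have "\<dots> = (\<Sum>j<n. d j ^ k)"
  proof (intro sum.cong refl)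
    fix j assume "j \<in> {..<n}"
    hence "(\<Sum>i<n. (U $$ (i, j))\<^sup>2) = (U\<^sup>T * U) $$ (j, j)"
      using U(6) by (simp add: scalar_prod_def atLeast0LessThan power2_eq_square)
    also have "\<dots> = 1" using U(2) \<open>j \<in> {..<n}\<close> by simp
    finally show "d j ^ k * (\<Sum>i<n. (U $$ (i, j))\<^sup>2) = d j ^ k" by simp
  qed
  finally show ?thesis .
qed

lemma trace_pow_even_nonneg:
  fixes A :: "real mat"
  assumes A: "A \<in> carrier_mat n n" and sym: "A\<^sup>T = A"
  shows "(\<Sum>i<n. (A ^\<^sub>m (2 * k)) $$ (i, i)) \<ge> 0"
proof -
  obtain U d where "similar_mat_wit A (mat_diag n d) U U\<^sup>T"
    using symmetric_diagonalization[OF A sym] by blast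
  from trace_pow_diagonalization[OF A this] show ?thesis
    by (simp add: sum_nonneg)
qed

lemma quad_form_le_of_trace_pow_le:
  fixes A :: "real mat"
  assumes A: "A \<in> carrier_mat n n" and sym: "A\<^sup>T = A" and \<rho>: "\<rho> \<ge> 0" and m: "m > 0"
    and trace: "(\<Sum>i<n. (A ^\<^sub>m (2 * m)) $$ (i, i)) \<le> \<rho> ^ (2 * m)"
  shows "\<bar>quad_form A x\<bar> \<le> \<rho> * (\<Sum>i<n. (x i)\<^sup>2)"
proof -
  obtain U d where wit: "similar_mat_wit A (mat_diag n d) U U\<^sup>T"
    using symmetric_diagonalization[OF A sym] by blast
  note U = similar_mat_witD2[OF A wit]
  have d: "\<bar>d j\<bar> \<le> \<rho>" if "j < n" for j
  proof -
    have "\<bar>d j\<bar> ^ (2 * m) = d j ^ (2 * m)" by (simp add: power_even_abs)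
    also have "\<dots> \<le> (\<Sum>j<n. d j ^ (2 * m))"
      using that by (intro member_le_sum) (auto simp: zero_le_even_power)
    also have "\<dots> \<le> \<rho> ^ (2 * m)" using trace by (simp add: trace_pow_diagonalization[OF A wit])
    finally show ?thesis using m \<rho> by (simp add: power_mono_iff)
  qed
  define y where "y = U\<^sup>T *\<^sub>v Matrix.vec n x"
  have y: "y \<in> carrier_vec n" using U by (simp add: y_def)
  have "U *\<^sub>v y = Matrix.vec n x"
    unfolding y_def using U by (simp flip: assoc_mult_mat_vec[of _ n n _ n])
  hence x: "x i = (U *\<^sub>v y) $ i" if "i < n" for i using that by simp
  have "\<bar>quad_form A x\<bar> = \<bar>quad_form A (\<lambda>i. (U *\<^sub>v y) $ i)\<bar>"
    using A x by (simp add: bilinear_form_def)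
  also have "\<dots> \<le> (\<Sum>j<n. \<bar>d j * (y $ j)\<^sup>2\<bar>)"
    unfolding quad_form_diagonalization(1)[OF A wit y] by (rule sum_abs)
  also have "\<dots> \<le> (\<Sum>j<n. \<rho> * (y $ j)\<^sup>2)"
    using d by (intro sum_mono) (auto simp: abs_mult intro!: mult_right_mono)
  also have "\<dots> = \<rho> * (\<Sum>i<n. (x i)\<^sup>2)"
    using quad_form_diagonalization(2)[OF A wit y] x by (simp flip: sum_distrib_left)
  finally show ?thesis .
qed

section \<open>Spectral norms and block matrices\<close>

lemma sum_lessThan_add:
  fixes g :: "nat \<Rightarrow> 'a::comm_monoid_add"
  shows "(\<Sum>i<m + n. g i) = (\<Sum>i<m. g i) + (\<Sum>j<n. g (m + j))"
  by (induction n) (simp_all add: add.assoc)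

lemma L2_set_power2: "(L2_set f A)\<^sup>2 = (\<Sum>i\<in>A. (f i)\<^sup>2)"
  by (simp add: L2_set_def sum_nonneg)

definition spectral_norm_le :: "real mat \<Rightarrow> real \<Rightarrow> bool" where
  "spectral_norm_le A \<rho> \<longleftrightarrow>
     (\<forall>x y. \<bar>bilinear_form A x y\<bar> \<le> \<rho> * L2_set x {..<dim_row A} * L2_set y {..<dim_col A})"

lemma spectral_norm_le_uminus: "spectral_norm_le (- A) \<rho> \<longleftrightarrow> spectral_norm_le A \<rho>"
  by (simp add: spectral_norm_le_def)

lemma spectral_norm_leD:
  assumes "spectral_norm_le A \<rho>" "\<rho> \<ge> 0"
  shows "2 * \<bar>bilinear_form A x y\<bar> \<le> \<rho> * ((\<Sum>i<dim_row A. (x i)\<^sup>2) + (\<Sum>j<dim_col A. (y j)\<^sup>2))"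
proof -
  let ?a = "L2_set x {..<dim_row A}" and ?b = "L2_set y {..<dim_col A}"
  have "2 * \<bar>bilinear_form A x y\<bar> \<le> 2 * (\<rho> * ?a * ?b)"
    using assms(1) by (simp add: spectral_norm_le_def)
  also have "\<dots> = \<rho> * (2 * ?a * ?b)" by simp
  also have "\<dots> \<le> \<rho> * (?a\<^sup>2 + ?b\<^sup>2)"
    using assms(2) by (intro mult_left_mono sum_squares_bound)
  finally show ?thesis by (simp add: L2_set_power2)
qed

lemma spectral_norm_leI:
  assumes bound: "\<And>x y. 2 * \<bar>bilinear_form A x y\<bar>
    \<le> \<rho> * ((\<Sum>i<dim_row A. (x i)\<^sup>2) + (\<Sum>j<dim_col A. (y j)\<^sup>2))"
  shows "spectral_norm_le A \<rho>"
  unfolding spectral_norm_le_def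
proof (intro allI)
  fix x y
  let ?a = "L2_set x {..<dim_row A}" and ?b = "L2_set y {..<dim_col A}"
  show "\<bar>bilinear_form A x y\<bar> \<le> \<rho> * ?a * ?b"
  proof (cases "?a = 0 \<or> ?b = 0")
    case True
    hence "bilinear_form A x y = 0"
      by (auto simp: bilinear_form_def L2_set_eq_0_iff intro!: sum.neutral)
    thus ?thesis using True by auto
  next
    case False
    hence pos: "?a > 0" "?b > 0"
      by (metis L2_set_nonneg less_eq_real_def)+
    have unit: "(\<Sum>i\<in>I. (f i / L2_set f I)\<^sup>2) = 1" if "L2_set f I > 0" for f :: "nat \<Rightarrow> real" and I
      using that by (simp add: power_divide L2_set_power2[symmetric] flip: sum_divide_distrib)
    have "bilinear_form A x y = ?a * ?b * bilinear_form A (\<lambda>i. x i / ?a) (\<lambda>j. y j / ?b)"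
      using pos by (simp add: bilinear_form_def sum_distrib_left)
    also have "\<bar>\<dots>\<bar> = ?a * ?b * \<bar>bilinear_form A (\<lambda>i. x i / ?a) (\<lambda>j. y j / ?b)\<bar>"
      using pos by (simp add: abs_mult)
    also have "\<dots> \<le> ?a * ?b * \<rho>"
      using bound[of "\<lambda>i. x i / ?a" "\<lambda>j. y j / ?b"] pos
      unfolding unit[OF pos(1)] unit[OF pos(2)] by (intro mult_left_mono) auto
    finally show ?thesis by (simp add: mult_ac)
  qed
qed

lemma spectral_norm_le_scale:
  fixes r s :: "nat \<Rightarrow> real"
  assumes norm: "spectral_norm_le A \<rho>" and \<rho>: "\<rho> \<ge> 0" and \<alpha>: "\<alpha> \<ge> 0" and \<gamma>: "\<gamma> \<ge> 0"
    and r: "\<And>i. i < dim_row A \<Longrightarrow> \<bar>r i\<bar> \<le> \<alpha>" and s: "\<And>j. j < dim_col A \<Longrightarrow> \<bar>s j\<bar> \<le> \<gamma>"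
  shows "spectral_norm_le (Matrix.mat (dim_row A) (dim_col A)
    (\<lambda>(i, j). r i * A $$ (i, j) * s j)) (\<alpha> * \<rho> * \<gamma>)"
  unfolding spectral_norm_le_def
proof (intro allI)
  fix x y
  let ?B = "Matrix.mat (dim_row A) (dim_col A) (\<lambda>(i, j). r i * A $$ (i, j) * s j)"
  have L2: "L2_set (\<lambda>i. q i * z i) {..<n} \<le> c * L2_set z {..<n}"
    if "c \<ge> 0" "\<And>i. i < n \<Longrightarrow> \<bar>q i\<bar> \<le> c" for c n and q z :: "nat \<Rightarrow> real"
  proof -
    have "L2_set (\<lambda>i. \<bar>q i\<bar> * \<bar>z i\<bar>) {..<n} \<le> L2_set (\<lambda>i. c * \<bar>z i\<bar>) {..<n}"
      using that by (intro L2_set_mono mult_right_mono) auto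
    thus ?thesis using that(1)
      by (simp add: L2_set_right_distrib) (simp add: L2_set_def power_mult_distrib)
  qed
  have "\<bar>bilinear_form ?B x y\<bar> = \<bar>bilinear_form A (\<lambda>i. r i * x i) (\<lambda>j. s j * y j)\<bar>"
    by (simp add: bilinear_form_def mult_ac)
  also have "\<dots> \<le> \<rho> * L2_set (\<lambda>i. r i * x i) {..<dim_row A} * L2_set (\<lambda>j. s j * y j) {..<dim_col A}"
    using norm by (simp add: spectral_norm_le_def)
  also have "\<dots> \<le> \<rho> * (\<alpha> * L2_set x {..<dim_row A}) * (\<gamma> * L2_set y {..<dim_col A})"
    using \<rho> \<alpha> \<gamma> r s by (intro mult_mono mult_left_mono L2) auto
  finally show "\<bar>bilinear_form ?B x y\<bar>
    \<le> \<alpha> * \<rho> * \<gamma> * L2_set x {..<dim_row ?B} * L2_set y {..<dim_col ?B}"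
    by (simp add: mult_ac)
qed

lemma quad_form_block:
  assumes M: "M \<in> carrier_mat (m + n) (m + n)" and sym: "M\<^sup>T = M"
    and diag: "\<And>u v. u < m + n \<Longrightarrow> v < m + n \<Longrightarrow> (u < m \<longleftrightarrow> v < m) \<Longrightarrow> M $$ (u, v) = s * of_bool (u = v)"
  shows "quad_form M x = s * (\<Sum>u<m + n. (x u)\<^sup>2)
    + 2 * bilinear_form (Matrix.mat m n (\<lambda>(i, j). M $$ (i, m + j))) x (\<lambda>j. x (m + j))"
proof -
  have sym': "M $$ (m + j, i) = M $$ (i, m + j)" if "i < m" "j < n" for i j
    using arg_cong[OF sym, of "\<lambda>A. A $$ (i, m + j)"] M that by simp
  have delta: "(\<Sum>i<l. \<Sum>j<l. s * of_bool (i = j) * z i * z j) = s * (\<Sum>i<l. (z i)\<^sup>2)"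
    for l and z :: "nat \<Rightarrow> real"
  proof -
    have "(\<Sum>j<l. s * of_bool (i = j) * z i * z j) = (\<Sum>j<l. if j = i then s * (z i)\<^sup>2 else 0)" for i
      by (intro sum.cong) (auto simp: power2_eq_square)
    thus ?thesis by (simp add: sum_distrib_left)
  qed
  have "quad_form M x = (\<Sum>i<m. \<Sum>j<m. M $$ (i, j) * x i * x j)
      + (\<Sum>i<m. \<Sum>j<n. M $$ (i, m + j) * x i * x (m + j))
      + ((\<Sum>j<n. \<Sum>i<m. M $$ (i, m + j) * x (m + j) * x i)
      + (\<Sum>i<n. \<Sum>j<n. M $$ (m + i, m + j) * x (m + i) * x (m + j)))"
    using M by (simp add: bilinear_form_def sum_lessThan_add sum.distrib sym')
  also have "(\<Sum>i<m. \<Sum>j<m. M $$ (i, j) * x i * x j) = s * (\<Sum>i<m. (x i)\<^sup>2)"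
    using delta[where l = m and z = x] by (simp add: diag)
  also have "(\<Sum>i<n. \<Sum>j<n. M $$ (m + i, m + j) * x (m + i) * x (m + j)) = s * (\<Sum>i<n. (x (m + i))\<^sup>2)"
    using delta[where l = n and z = "\<lambda>i. x (m + i)"] by (simp add: diag)
  also have "(\<Sum>j<n. \<Sum>i<m. M $$ (i, m + j) * x (m + j) * x i)
      = (\<Sum>i<m. \<Sum>j<n. M $$ (i, m + j) * x i * x (m + j))"
    by (subst sum.swap) (simp add: mult_ac)
  finally show ?thesis
    by (simp add: bilinear_form_def sum_lessThan_add algebra_simps)
qed

lemma spectral_norm_le_of_quad_form_block:
  assumes M: "M \<in> carrier_mat (m + n) (m + n)" and sym: "M\<^sup>T = M"
    and diag: "\<And>u v. u < m + n \<Longrightarrow> v < m + n \<Longrightarrow> (u < m \<longleftrightarrow> v < m) \<Longrightarrow> M $$ (u, v) = 0"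
    and bound: "\<And>x. \<bar>quad_form M x\<bar> \<le> \<rho> * (\<Sum>u<m + n. (x u)\<^sup>2)"
  shows "spectral_norm_le (Matrix.mat m n (\<lambda>(i, j). M $$ (i, m + j))) \<rho>"
proof (rule spectral_norm_leI)
  fix x y :: "nat \<Rightarrow> real"
  let ?B = "Matrix.mat m n (\<lambda>(i, j). M $$ (i, m + j))"
  define z where "z u = (if u < m then x u else y (u - m))" for u
  have "quad_form M z = 2 * bilinear_form ?B z (\<lambda>j. z (m + j))"
    using quad_form_block[OF M sym, of 0 z] diag by simp
  also have "bilinear_form ?B z (\<lambda>j. z (m + j)) = bilinear_form ?B x y"
    by (simp add: bilinear_form_def z_def)
  finally have "quad_form M z = 2 * bilinear_form ?B x y" .
  moreover have "(\<Sum>u<m + n. (z u)\<^sup>2) = (\<Sum>i<m. (x i)\<^sup>2) + (\<Sum>j<n. (y j)\<^sup>2)"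
    by (simp add: sum_lessThan_add z_def)
  ultimately show "2 * \<bar>bilinear_form ?B x y\<bar>
    \<le> \<rho> * ((\<Sum>i<dim_row ?B. (x i)\<^sup>2) + (\<Sum>j<dim_col ?B. (y j)\<^sup>2))"
    using bound[of z] by (simp add: abs_mult)
qed

lemma mu_block_near:
  assumes M: "M \<in> carrier_mat (m + n) (m + n)" and sym: "M\<^sup>T = M"
    and diag: "\<And>u v. u < m + n \<Longrightarrow> v < m + n \<Longrightarrow> (u < m \<longleftrightarrow> v < m) \<Longrightarrow> M $$ (u, v) = s * of_bool (u = v)"
    and norm: "spectral_norm_le (Matrix.mat m n (\<lambda>(i, j). M $$ (i, m + j) - a i * b j)) \<beta>"
    and \<beta>: "\<beta> \<ge> 0"
    and k: "1 < k" "k < m + n"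
  shows "\<bar>mu k M - s\<bar> \<le> \<beta>"
proof (rule mu_near[OF M sym k])
  fix x :: "nat \<Rightarrow> real"
  let ?B = "Matrix.mat m n (\<lambda>(i, j). M $$ (i, m + j))"
  let ?y = "\<lambda>j. x (m + j)"
  let ?a = "\<lambda>u. if u < m then a u else 0" and ?b = "\<lambda>u. if u < m then 0 else b (u - m)"
  have "bilinear_form ?B x ?y - (\<Sum>i<m. a i * x i) * (\<Sum>j<n. b j * ?y j)
      = bilinear_form (Matrix.mat m n (\<lambda>(i, j). M $$ (i, m + j) - a i * b j)) x ?y"
    by (simp add: bilinear_form_def sum_product algebra_simps sum_subtractf)
  hence "quad_form M x - s * (\<Sum>u<m + n. (x u)\<^sup>2)
      - 2 * (\<Sum>u<m + n. ?a u * x u) * (\<Sum>u<m + n. ?b u * x u)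
      = 2 * bilinear_form (Matrix.mat m n (\<lambda>(i, j). M $$ (i, m + j) - a i * b j)) x ?y"
    by (simp add: quad_form_block[OF M sym diag] sum_lessThan_add[of "\<lambda>u. _ u * x u"])
  thus "\<bar>quad_form M x - s * (\<Sum>u<m + n. (x u)\<^sup>2)
      - 2 * (\<Sum>u<m + n. ?a u * x u) * (\<Sum>u<m + n. ?b u * x u)\<bar>
      \<le> \<beta> * (\<Sum>u<m + n. (x u)\<^sup>2)"
    using spectral_norm_leD[OF norm \<beta>, of x ?y] by (simp add: sum_lessThan_add abs_mult)
qed

section \<open>Events of high probability\<close>

lemma prob_Compl: "measure_pmf.prob P (- A) = 1 - measure_pmf.prob P A"
  using measure_pmf.prob_compl[of A P] by (simp add: Compl_eq_Diff_UNIV)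

lemma prob_less_ge_Markov:
  fixes u :: "'a \<Rightarrow> real"
  assumes "finite (set_pmf P)" "\<And>x. u x \<ge> 0" "c > 0"
  shows "measure_pmf.prob P {x. u x < c} \<ge> 1 - measure_pmf.expectation P u / c"
proof -
  have "{x. u x < c} = - {x. c \<le> u x}" by auto
  hence "measure_pmf.prob P {x. u x < c} = 1 - measure_pmf.prob P {x. c \<le> u x}"
    by (simp only: prob_Compl)
  moreover have "measure_pmf.prob P {x. c \<le> u x} \<le> measure_pmf.expectation P u / c"
    using integral_Markov_inequality_measure[of "measure_pmf P" u "{}" c] assms
    by (simp add: integrable_measure_pmf_finite)
  ultimately show ?thesis by linarith
qed

lemma prob_Ball_ge:
  assumes "finite I" "\<And>i. i \<in> I \<Longrightarrow> measure_pmf.prob P {x. Q i x} \<ge> 1 - b"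
  shows "measure_pmf.prob P {x. \<forall>i\<in>I. Q i x} \<ge> 1 - real (card I) * b"
proof -
  have "1 - measure_pmf.prob P {x. \<forall>i\<in>I. Q i x} = measure_pmf.prob P (- {x. \<forall>i\<in>I. Q i x})"
    by (rule prob_Compl[symmetric])
  also have "- {x. \<forall>i\<in>I. Q i x} = (\<Union>i\<in>I. - {x. Q i x})" by auto
  also have "measure_pmf.prob P \<dots> \<le> (\<Sum>i\<in>I. measure_pmf.prob P (- {x. Q i x}))"
    using assms(1) by (intro measure_UNION_le) auto
  also have "\<dots> \<le> real (card I) * b"
  proof (intro sum_bounded_above)
    show "measure_pmf.prob P (- {x. Q i x}) \<le> b" if "i \<in> I" for i
      using assms(2)[OF that] by (simp add: prob_Compl)
  qed
  finally show ?thesis by linarith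
qed

lemma prob_conj_ge:
  assumes "measure_pmf.prob P {x. Q x} \<ge> 1 - a" "measure_pmf.prob P {x. R x} \<ge> 1 - b"
  shows "measure_pmf.prob P {x. Q x \<and> R x} \<ge> 1 - (a + b)"
proof -
  have "measure_pmf.prob P (- {x. Q x \<and> R x}) = measure_pmf.prob P (- {x. Q x} \<union> - {x. R x})"
    by (intro arg_cong[of _ _ "measure_pmf.prob P"]) auto
  also have "\<dots> \<le> measure_pmf.prob P (- {x. Q x}) + measure_pmf.prob P (- {x. R x})"
    by (intro measure_Un_le) auto
  finally show ?thesis
    using assms by (simp add: prob_Compl)
qed

section \<open>The trace method\<close>

text \<open>Because of the truncated subtraction, a vertex of degree 0 contributes 0.\<close>
definition excess :: "nat \<Rightarrow> nat set set \<Rightarrow> nat \<Rightarrow> nat" where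
  "excess n H w = (\<Sum>v<n. (vertex_degree H v + of_bool (v = w) - 1) div 2)"

lemma vertex_degree_insert:
  assumes "finite H" "e \<notin> H"
  shows "vertex_degree (insert e H) v = vertex_degree H v + of_bool (v \<in> e)"
proof -
  have "{x \<in> insert e H. v \<in> x} = (if v \<in> e then insert e {x \<in> H. v \<in> x} else {x \<in> H. v \<in> x})"
    by auto
  thus ?thesis using assms by (simp add: vertex_degree_def)
qed

lemma excess_insert:
  assumes "finite H" "{w, v} \<notin> H" "w \<noteq> v" "v < n"
  shows "excess n (insert {w, v} H) v \<le> excess n H w + of_bool (vertex_degree H v > 0)"
proof -
  have "excess n (insert {w, v} H) v \<le> (\<Sum>u<n. (vertex_degree H u + of_bool (u = w) - 1) div 2
      + (if u = v then of_bool (vertex_degree H v > 0) else 0))"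
    unfolding excess_def using assms by (intro sum_mono) (auto simp: vertex_degree_insert)
  thus ?thesis using assms(4) by (simp add: sum.distrib excess_def)
qed

lemma excess_remove:
  assumes "finite H" "{w, v} \<in> H" "w \<noteq> v" "w < n"
  shows "excess n (H - {{w, v}}) v + of_bool (vertex_degree H w \<ge> 2) \<le> excess n H w"
proof -
  define H' where "H' = H - {{w, v}}"
  have H: "H = insert {w, v} H'" "{w, v} \<notin> H'" "finite H'" using assms by (auto simp: H'_def)
  have "(\<Sum>u<n. (vertex_degree H' u + of_bool (u = v) - 1) div 2
      + (if u = w then of_bool (vertex_degree H w \<ge> 2) else 0)) \<le> excess n H w"
    unfolding excess_def H(1) using H(2,3) assms(3)
    by (intro sum_mono) (auto simp: vertex_degree_insert)
  thus ?thesis using assms(4) by (simp add: sum.distrib excess_def flip: H'_def)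
qed

lemma excess_move:
  assumes "v < n"
  shows "excess n H v \<le> excess n H w + 1"
proof -
  have "excess n H v
    \<le> (\<Sum>u<n. (vertex_degree H u + of_bool (u = w) - 1) div 2 + (if u = v then 1 else 0))"
    unfolding excess_def by (intro sum_mono) auto
  thus ?thesis using assms by (simp add: sum.distrib excess_def)
qed

lemma card_vertex_degree_pos_le:
  assumes "finite H" "\<And>e. e \<in> H \<Longrightarrow> card e = 2"
  shows "finite {v. vertex_degree H v > 0}" "card {v. vertex_degree H v > 0} \<le> 2 * card H"
proof -
  have eq: "{v. vertex_degree H v > 0} = \<Union>H"
    using assms(1) by (auto simp: vertex_degree_def card_gt_0_iff)
  show "finite {v. vertex_degree H v > 0}"
    unfolding eq using assms by (intro finite_Union) (auto intro: card_ge_0_finite)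
  have "card (\<Union>H) \<le> (\<Sum>e\<in>H. card e)" by (rule card_Union_le_sum_card)
  thus "card {v. vertex_degree H v > 0} \<le> 2 * card H" using assms(2) by (simp add: eq)
qed

lemma card_neighbours_le_vertex_degree:
  assumes "finite H"
  shows "card {v. {w, v} \<in> H} \<le> vertex_degree H w"
proof -
  have "card {v. {w, v} \<in> H} = card ((\<lambda>v. {w, v}) ` {v. {w, v} \<in> H})"
    by (intro card_image[symmetric]) (auto simp: inj_on_def doubleton_eq_iff)
  also have "\<dots> \<le> vertex_degree H w"
    unfolding vertex_degree_def using assms by (intro card_mono) auto
  finally show ?thesis .
qed

definition traverse :: "nat set \<Rightarrow> (nat set \<Rightarrow> nat) \<Rightarrow> nat set \<Rightarrow> nat" where
  "traverse e m = m(e := Suc (m e))"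

locale random_symmetric_matrix =
  fixes P :: "'a pmf" and Z :: "nat set \<Rightarrow> 'a \<Rightarrow> real"
    and G :: "nat set set" and n D :: nat and p :: real
  assumes finite_support: "finite (set_pmf P)"
    and edges: "\<And>e. e \<in> G \<Longrightarrow> \<exists>u v. e = {u, v} \<and> u \<noteq> v \<and> u < n \<and> v < n"
    and max_degree: "\<And>u. card {v. {u, v} \<in> G} \<le> D" "D \<ge> 1"
    and p: "0 < p" "p \<le> 1"
    and moments: "\<And>m :: nat set \<Rightarrow> nat. \<bar>measure_pmf.expectation P (\<lambda>\<omega>. \<Prod>e\<in>G. Z e \<omega> ^ m e)\<bar>
          \<le> (if \<exists>e\<in>G. m e = 1 then 0 else p ^ card {e \<in> G. m e > 0})"
begin

definition X :: "'a \<Rightarrow> real mat" where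
  "X \<omega> = Matrix.mat n n (\<lambda>(u, v). if {u, v} \<in> G then Z {u, v} \<omega> else 0)"

definition \<sigma> :: real where "\<sigma> = sqrt (real D * p)"

definition monomial :: "(nat set \<Rightarrow> nat) \<Rightarrow> 'a \<Rightarrow> real" where
  "monomial m \<omega> = (\<Prod>e\<in>G. Z e \<omega> ^ m e)"

definition walk_moment :: "nat \<Rightarrow> nat \<Rightarrow> (nat set \<Rightarrow> nat) \<Rightarrow> nat \<Rightarrow> real" where
  "walk_moment w0 l m w = measure_pmf.expectation P (\<lambda>\<omega>. monomial m \<omega> * (X \<omega> ^\<^sub>m l) $$ (w0, w))"

definition neighbours :: "nat \<Rightarrow> nat set" where "neighbours u = {v. {u, v} \<in> G}"

definition visited :: "(nat set \<Rightarrow> nat) \<Rightarrow> nat set set" where "visited m = {e \<in> G. m e > 0}"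

definition once :: "(nat set \<Rightarrow> nat) \<Rightarrow> nat set set" where "once m = {e \<in> G. m e = 1}"

text \<open>A step of the walk from \<open>w\<close> to \<open>v\<close> uses a new edge, an edge traversed exactly once before,
  or an edge traversed at least twice before. The factor \<open>1 / \<sigma>\<close> per singly traversed edge balances
  the first two kinds of steps. A vertex at which several edges are still waiting for their second
  traversal offers a choice of edges, and this choice is paid for by the factor \<open>K\<close> that was gained
  when the walk returned to an already occupied vertex. Counting the current vertex as having one
  more edge makes \<open>excess\<close> change only at such events.\<close>
definition potential :: "real \<Rightarrow> (nat set \<Rightarrow> nat) \<Rightarrow> nat \<Rightarrow> real" where
  "potential K m w = p ^ card (visited m) / \<sigma> ^ card (once m) * K ^ excess n (once m) w"

lemma integrable [simp]: "integrable (measure_pmf P) (f :: 'a \<Rightarrow> real)"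
  by (rule integrable_measure_pmf_finite[OF finite_support])

lemma \<sigma>_pos: "\<sigma> > 0"
  using p max_degree(2) by (simp add: \<sigma>_def)

lemma p_mult_D: "p * real D = \<sigma>\<^sup>2"
  using p by (simp add: \<sigma>_def)

lemma p_le_\<sigma>: "p \<le> \<sigma>"
proof -
  have "p\<^sup>2 \<le> real D * p"
    unfolding power2_eq_square using p max_degree(2) by (intro mult_right_mono) auto
  thus ?thesis unfolding \<sigma>_def by (rule real_le_rsqrt)
qed

lemma finite_G: "finite G"
  by (rule finite_subset[of _ "Pow {..<n}"]) (use edges in auto)

lemma card_edge: "e \<in> G \<Longrightarrow> card e = 2"
  using edges[of e] by auto

lemma edgeD: "{u, v} \<in> G \<Longrightarrow> u \<noteq> v \<and> u < n \<and> v < n"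
  using edges[of "{u, v}"] by (auto simp: doubleton_eq_iff)

lemma neighbours_subset: "neighbours u \<subseteq> {..<n}"
  using edgeD by (auto simp: neighbours_def)

lemma finite_neighbours: "finite (neighbours u)"
  using neighbours_subset finite_subset by blast

lemma finite_visited: "finite (visited m)" and finite_once: "finite (once m)"
  using finite_G by (auto simp: visited_def once_def)

lemma card_once_le_visited: "card (once m) \<le> card (visited m)"
  by (intro card_mono finite_visited) (auto simp: visited_def once_def)

lemma vertex_degree_le_visited: "H \<subseteq> visited m \<Longrightarrow> vertex_degree H v \<le> card (visited m)"
  unfolding vertex_degree_def by (intro card_mono finite_visited) auto

lemma card_visited_traverse_le: "card (visited (traverse e m)) \<le> Suc (card (visited m))"
proof -
  have "card (visited (traverse e m)) \<le> card (insert e (visited m))"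
    using finite_visited by (intro card_mono) (auto simp: visited_def traverse_def)
  thus ?thesis using finite_visited[of m] by (simp add: card_insert_if split: if_splits)
qed

lemma potential_nonneg: "K \<ge> 0 \<Longrightarrow> potential K m w \<ge> 0"
  using p \<sigma>_pos by (simp add: potential_def)

lemma potential_traverse_new:
  assumes e: "{w, v} \<in> G" "m {w, v} = 0" and K: "K \<ge> 1"
  shows "potential K (traverse {w, v} m) v
      \<le> potential K m w * (p / \<sigma> * (1 + of_bool (vertex_degree (once m) v > 0) * K))"
proof -
  let ?m = "traverse {w, v} m" and ?I = "of_bool (vertex_degree (once m) v > 0)"
  have "visited ?m = insert {w, v} (visited m)" "{w, v} \<notin> visited m"
    using e by (auto simp: visited_def traverse_def)
  hence card_visited: "card (visited ?m) = Suc (card (visited m))" using finite_visited by simp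
  have once: "once ?m = insert {w, v} (once m)" "{w, v} \<notin> once m"
    using e by (auto simp: once_def traverse_def)
  hence card_once: "card (once ?m) = Suc (card (once m))" using finite_once by simp
  have "excess n (once ?m) v \<le> excess n (once m) w + ?I"
    unfolding once(1) using edgeD[OF e(1)] once(2) finite_once by (intro excess_insert) auto
  hence "K ^ excess n (once ?m) v \<le> K ^ (excess n (once m) w + ?I)"
    using K by (rule power_increasing)
  also have "\<dots> \<le> K ^ excess n (once m) w * (1 + ?I * K)"
    using K by (auto simp: power_add algebra_simps)
  finally have "potential K ?m v
    \<le> p ^ card (visited ?m) / \<sigma> ^ card (once ?m) * (K ^ excess n (once m) w * (1 + ?I * K))"
    unfolding potential_def using p \<sigma>_pos by (intro mult_left_mono) auto
  also have "\<dots> = potential K m w * (p / \<sigma> * (1 + ?I * K))"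
    unfolding potential_def card_visited card_once by (simp add: mult_ac)
  finally show ?thesis .
qed

lemma potential_traverse_second:
  assumes e: "{w, v} \<in> G" "m {w, v} = 1" and K: "K \<ge> 1"
  shows "potential K (traverse {w, v} m) v * (if vertex_degree (once m) w \<ge> 2 then K else 1)
      \<le> potential K m w * \<sigma>"
proof -
  let ?m = "traverse {w, v} m" and ?I = "of_bool (vertex_degree (once m) w \<ge> 2)"
  have visited: "visited ?m = visited m"
    using e by (auto simp: visited_def traverse_def)
  have once: "once ?m = once m - {{w, v}}" "{w, v} \<in> once m"
    using e by (auto simp: once_def traverse_def)
  hence card_once: "card (once m) = Suc (card (once ?m))"
    using finite_once by (metis card.remove)
  have "excess n (once ?m) v + ?I \<le> excess n (once m) w"
    unfolding once(1) using edgeD[OF e(1)] once(2) finite_once by (intro excess_remove) auto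
  hence "K ^ (excess n (once ?m) v + ?I) \<le> K ^ excess n (once m) w"
    using K by (rule power_increasing)
  also have "K ^ (excess n (once ?m) v + ?I)
      = K ^ excess n (once ?m) v * (if vertex_degree (once m) w \<ge> 2 then K else 1)"
    by simp
  finally have "p ^ card (visited m) / \<sigma> ^ card (once ?m)
        * (K ^ excess n (once ?m) v * (if vertex_degree (once m) w \<ge> 2 then K else 1))
      \<le> p ^ card (visited m) / \<sigma> ^ card (once ?m) * K ^ excess n (once m) w"
    using p \<sigma>_pos by (intro mult_left_mono) auto
  also have "\<dots> = potential K m w * \<sigma>"
    unfolding potential_def card_once using \<sigma>_pos by simp
  finally show ?thesis
    unfolding potential_def visited by (simp only: mult.assoc)
qed

lemma potential_traverse_later:
  assumes e: "{w, v} \<in> G" "m {w, v} \<ge> 2" and K: "K \<ge> 1"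
  shows "potential K (traverse {w, v} m) v \<le> potential K m w * K"
proof -
  let ?m = "traverse {w, v} m"
  have eq: "visited ?m = visited m" "once ?m = once m"
    using e by (auto simp: visited_def once_def traverse_def)
  have "K ^ excess n (once m) v \<le> K ^ (excess n (once m) w + 1)"
    using K edgeD[OF e(1)] by (intro power_increasing excess_move) auto
  hence "p ^ card (visited m) / \<sigma> ^ card (once m) * K ^ excess n (once m) v
      \<le> p ^ card (visited m) / \<sigma> ^ card (once m) * K ^ (excess n (once m) w + 1)"
    using p \<sigma>_pos by (intro mult_left_mono) auto
  thus ?thesis unfolding potential_def eq by (simp add: mult_ac)
qed

lemma sum_potential_new_le:
  assumes K: "K \<ge> 1" "real (card (visited m)) \<le> K"
  shows "(\<Sum>v\<in>{v \<in> neighbours w. m {w, v} = 0}. potential K (traverse {w, v} m) v)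
    \<le> potential K m w * (\<sigma> + 2 * K\<^sup>2)"
proof -
  let ?A = "{v \<in> neighbours w. m {w, v} = 0}" and ?\<phi> = "potential K m w"
  define I where "I v = (of_bool (vertex_degree (once m) v > 0) :: real)" for v
  have \<phi>: "?\<phi> \<ge> 0" using K by (intro potential_nonneg) simp
  have "card ?A \<le> card (neighbours w)" using finite_neighbours by (intro card_mono) auto
  hence card: "real (card ?A) \<le> real D" using max_degree(1)[of w] by (simp add: neighbours_def)
  note once = card_vertex_degree_pos_le[OF finite_once[of m]]
  have "(\<Sum>v\<in>?A. I v) = real (card {v \<in> ?A. vertex_degree (once m) v > 0})"
    unfolding I_def using finite_neighbours by (simp add: sum_of_bool_eq Int_def)
  also have "\<dots> \<le> real (card {v. vertex_degree (once m) v > 0})"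
    using once(1) card_edge by (intro of_nat_mono card_mono) (auto simp: once_def)
  also have "\<dots> \<le> 2 * real (card (once m))"
    using once(2) card_edge by (auto simp: once_def)
  also have "\<dots> \<le> 2 * K"
    using card_once_le_visited[of m] K by linarith
  finally have occupied: "(\<Sum>v\<in>?A. I v) \<le> 2 * K" .
  have "(\<Sum>v\<in>?A. potential K (traverse {w, v} m) v) \<le> (\<Sum>v\<in>?A. ?\<phi> * (p / \<sigma> * (1 + I v * K)))"
    unfolding I_def using K by (intro sum_mono potential_traverse_new) (auto simp: neighbours_def)
  also have "\<dots> = ?\<phi> * (p / \<sigma> * (real (card ?A) + (\<Sum>v\<in>?A. I v) * K))"
    by (simp add: sum_distrib_left sum_distrib_right sum.distrib algebra_simps)
  also have "\<dots> \<le> ?\<phi> * (p / \<sigma> * (real D + 2 * K * K))"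
    using card occupied \<phi> K p \<sigma>_pos by (intro mult_left_mono add_mono mult_right_mono) auto
  also have "\<dots> = ?\<phi> * (\<sigma> + p / \<sigma> * (2 * K\<^sup>2))"
    using p_mult_D \<sigma>_pos by (simp add: power2_eq_square distrib_left)
  also have "\<dots> \<le> ?\<phi> * (\<sigma> + 1 * (2 * K\<^sup>2))"
    using \<phi> p_le_\<sigma> \<sigma>_pos by (intro mult_left_mono add_left_mono mult_right_mono) auto
  finally show ?thesis by simp
qed

lemma sum_potential_second_le:
  assumes K: "K \<ge> 1" "real (card (visited m)) \<le> K"
  shows "(\<Sum>v\<in>{v \<in> neighbours w. m {w, v} = 1}. potential K (traverse {w, v} m) v)
    \<le> potential K m w * \<sigma>"
proof -
  let ?A = "{v \<in> neighbours w. m {w, v} = 1}" and ?\<phi> = "potential K m w"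
  define k where "k = (if vertex_degree (once m) w \<ge> 2 then K else 1)"
  have k: "k > 0" using K by (simp add: k_def)
  have "?A = {v. {w, v} \<in> once m}" by (auto simp: once_def neighbours_def)
  hence "card ?A \<le> vertex_degree (once m) w"
    using card_neighbours_le_vertex_degree[OF finite_once] by simp
  moreover have "once m \<subseteq> visited m" by (auto simp: once_def visited_def)
  hence "real (vertex_degree (once m) w) \<le> K"
    using vertex_degree_le_visited K(2) by (meson of_nat_le_iff order_trans)
  ultimately have card: "real (card ?A) \<le> k" by (auto simp: k_def)
  have "potential K (traverse {w, v} m) v \<le> ?\<phi> * \<sigma> / k" if "v \<in> ?A" for v
    using potential_traverse_second[of w v m K] that K k
    by (simp add: neighbours_def k_def pos_le_divide_eq)
  hence "(\<Sum>v\<in>?A. potential K (traverse {w, v} m) v) \<le> real (card ?A) * (?\<phi> * \<sigma> / k)"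
    by (intro sum_bounded_above) auto
  also have "\<dots> = ?\<phi> * \<sigma> * (real (card ?A) / k)" by simp
  also have "\<dots> \<le> ?\<phi> * \<sigma> * 1"
    using card k K \<sigma>_pos potential_nonneg[of K m w] by (intro mult_left_mono) auto
  finally show ?thesis by simp
qed

lemma sum_potential_later_le:
  assumes K: "K \<ge> 1" "real (card (visited m)) \<le> K"
  shows "(\<Sum>v\<in>{v \<in> neighbours w. m {w, v} \<ge> 2}. potential K (traverse {w, v} m) v)
    \<le> potential K m w * K\<^sup>2"
proof -
  let ?A = "{v \<in> neighbours w. m {w, v} \<ge> 2}" and ?H = "{e \<in> G. m e \<ge> 2}"
  have "?A = {v. {w, v} \<in> ?H}" by (auto simp: neighbours_def)
  hence "card ?A \<le> vertex_degree ?H w"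
    using card_neighbours_le_vertex_degree[of ?H w] finite_G by simp
  also have "\<dots> \<le> card (visited m)"
    by (intro vertex_degree_le_visited) (auto simp: visited_def)
  finally have card: "real (card ?A) \<le> K" using K(2) by linarith
  have "(\<Sum>v\<in>?A. potential K (traverse {w, v} m) v) \<le> real (card ?A) * (potential K m w * K)"
    using K by (intro sum_bounded_above potential_traverse_later) (auto simp: neighbours_def)
  also have "\<dots> \<le> K * (potential K m w * K)"
    using card K potential_nonneg[of K m w] by (intro mult_right_mono) auto
  finally show ?thesis by (simp add: power2_eq_square mult_ac)
qed

lemma sum_potential_le:
  assumes K: "K \<ge> 1" "real (card (visited m)) \<le> K"
  shows "(\<Sum>v\<in>neighbours w. potential K (traverse {w, v} m) v) \<le> potential K m w * (2 * \<sigma> + 3 * K\<^sup>2)"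
proof -
  let ?A = "\<lambda>Q. {v \<in> neighbours w. Q (m {w, v})}" and ?f = "\<lambda>v. potential K (traverse {w, v} m) v"
  have split: "neighbours w = ?A (\<lambda>k. k = 0) \<union> (?A (\<lambda>k. k = 1) \<union> ?A (\<lambda>k. k \<ge> 2))" by force
  have "sum ?f (neighbours w) = sum ?f (?A (\<lambda>k. k = 0) \<union> (?A (\<lambda>k. k = 1) \<union> ?A (\<lambda>k. k \<ge> 2)))"
    using split by (rule arg_cong)
  also have "\<dots> = sum ?f (?A (\<lambda>k. k = 0)) + (sum ?f (?A (\<lambda>k. k = 1)) + sum ?f (?A (\<lambda>k. k \<ge> 2)))"
    using finite_neighbours[of w] by (simp add: sum.union_disjoint disjoint_iff)
  also have "\<dots> \<le> potential K m w * (\<sigma> + 2 * K\<^sup>2) + (potential K m w * \<sigma> + potential K m w * K\<^sup>2)"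
    using K by (intro add_mono sum_potential_new_le sum_potential_second_le sum_potential_later_le)
  finally show ?thesis by (simp add: algebra_simps)
qed

lemma monomial_traverse:
  assumes "e \<in> G"
  shows "monomial (traverse e m) \<omega> = monomial m \<omega> * Z e \<omega>"
proof -
  have "monomial (traverse e m) \<omega> = Z e \<omega> ^ Suc (m e) * (\<Prod>f\<in>G - {e}. Z f \<omega> ^ m f)"
    unfolding monomial_def traverse_def using assms finite_G
    by (subst prod.remove[of _ e]) (auto intro!: prod.cong)
  also have "\<dots> = monomial m \<omega> * Z e \<omega>"
    unfolding monomial_def using assms finite_G by (subst prod.remove[of G e]) auto
  finally show ?thesis .
qed

lemma walk_moment_Suc:
  assumes "w0 < n" "w < n"
  shows "walk_moment w0 (Suc l) m w = (\<Sum>v\<in>neighbours w. walk_moment w0 l (traverse {w, v} m) v)"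
proof -
  have "(X \<omega> ^\<^sub>m Suc l) $$ (w0, w) = (\<Sum>v\<in>neighbours w. (X \<omega> ^\<^sub>m l) $$ (w0, v) * Z {w, v} \<omega>)" for \<omega>
  proof -
    have "X \<omega> \<in> carrier_mat n n" by (simp add: X_def)
    hence "(X \<omega> ^\<^sub>m Suc l) $$ (w0, w) = (\<Sum>v<n. (X \<omega> ^\<^sub>m l) $$ (w0, v) * X \<omega> $$ (v, w))"
      using assms by (simp add: scalar_prod_def atLeast0LessThan)
    also have "\<dots> = (\<Sum>v\<in>neighbours w. (X \<omega> ^\<^sub>m l) $$ (w0, v) * Z {w, v} \<omega>)"
      using neighbours_subset[of w] assms
      by (intro sum.mono_neutral_cong_right) (auto simp: X_def neighbours_def insert_commute)
    finally show ?thesis .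
  qed
  hence "monomial m \<omega> * (X \<omega> ^\<^sub>m Suc l) $$ (w0, w)
      = (\<Sum>v\<in>neighbours w. monomial (traverse {w, v} m) \<omega> * (X \<omega> ^\<^sub>m l) $$ (w0, v))" for \<omega>
    by (auto simp: sum_distrib_left monomial_traverse neighbours_def mult_ac
      simp del: pow_mat.simps intro!: sum.cong)
  thus ?thesis by (simp add: walk_moment_def)
qed

lemma abs_expectation_monomial_le:
  assumes "K \<ge> 1"
  shows "\<bar>measure_pmf.expectation P (monomial m)\<bar> \<le> potential K m w"
proof (cases "\<exists>e\<in>G. m e = 1")
  case True
  hence "measure_pmf.expectation P (monomial m) = 0"
    using moments[of m] by (simp add: monomial_def[abs_def])
  thus ?thesis using assms potential_nonneg[of K] by simp
next
  case False
  hence "once m = {}" by (auto simp: once_def)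
  have "\<bar>measure_pmf.expectation P (monomial m)\<bar> \<le> p ^ card (visited m) * 1"
    using moments[of m] False by (simp add: monomial_def[abs_def] visited_def)
  also have "\<dots> \<le> p ^ card (visited m) * K ^ excess n {} w"
    using assms p by (intro mult_left_mono one_le_power) auto
  finally show ?thesis by (simp add: potential_def \<open>once m = {}\<close>)
qed

lemma abs_walk_moment_le:
  assumes K: "K \<ge> 1" and "w0 < n" "w < n" and "real (card (visited m) + l) \<le> K"
  shows "\<bar>walk_moment w0 l m w\<bar> \<le> (2 * \<sigma> + 3 * K\<^sup>2) ^ l * potential K m w"
  using assms(3,4)
proof (induction l arbitrary: m w)
  case 0
  have "\<bar>walk_moment w0 0 m w\<bar> \<le> \<bar>measure_pmf.expectation P (monomial m)\<bar>"
    using 0 assms(2) by (auto simp: walk_moment_def X_def)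
  also have "\<dots> \<le> potential K m w" using K by (rule abs_expectation_monomial_le)
  finally show ?case by simp
next
  case (Suc l)
  let ?g = "2 * \<sigma> + 3 * K\<^sup>2"
  have g: "?g \<ge> 0" using \<sigma>_pos by simp
  have "\<bar>walk_moment w0 (Suc l) m w\<bar> \<le> (\<Sum>v\<in>neighbours w. \<bar>walk_moment w0 l (traverse {w, v} m) v\<bar>)"
    unfolding walk_moment_Suc[OF assms(2) Suc.prems(1)] by (rule sum_abs)
  also have "\<dots> \<le> (\<Sum>v\<in>neighbours w. ?g ^ l * potential K (traverse {w, v} m) v)"
  proof (intro sum_mono Suc.IH)
    fix v assume "v \<in> neighbours w"
    thus "v < n" using neighbours_subset by blast
    show "real (card (visited (traverse {w, v} m)) + l) \<le> K"
      using card_visited_traverse_le[of "{w, v}" m] Suc.prems(2) by linarith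
  qed
  also have "\<dots> = ?g ^ l * (\<Sum>v\<in>neighbours w. potential K (traverse {w, v} m) v)"
    by (rule sum_distrib_left[symmetric])
  also have "\<dots> \<le> ?g ^ l * (potential K m w * ?g)"
    using K g Suc.prems by (intro mult_left_mono sum_potential_le) auto
  finally show ?case by (simp add: mult_ac)
qed

lemma expectation_pow_diag_le:
  assumes "l \<ge> 1" "w < n"
  shows "measure_pmf.expectation P (\<lambda>\<omega>. (X \<omega> ^\<^sub>m l) $$ (w, w)) \<le> (2 * \<sigma> + 3 * (real l)\<^sup>2) ^ l"
proof -
  have empty: "visited (\<lambda>_. 0) = {}" "once (\<lambda>_. 0) = {}" by (auto simp: visited_def once_def)
  hence "potential (real l) (\<lambda>_. 0) w = 1" by (simp add: potential_def excess_def vertex_degree_def)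
  thus ?thesis
    using abs_walk_moment_le[of "real l" w w "\<lambda>_. 0" l] assms empty
    by (simp add: walk_moment_def monomial_def)
qed

lemma prob_quad_form_le_ge:
  assumes \<rho>: "\<rho> > 0" and k: "k > 0"
  shows "measure_pmf.prob P {\<omega>. \<forall>x. \<bar>quad_form (X \<omega>) x\<bar> \<le> \<rho> * (\<Sum>i<n. (x i)\<^sup>2)}
      \<ge> 1 - real n * ((2 * \<sigma> + 3 * (real (2 * k))\<^sup>2) / \<rho>) ^ (2 * k)"
proof -
  let ?l = "2 * k"
  define trace where "trace \<omega> = (\<Sum>i<n. (X \<omega> ^\<^sub>m ?l) $$ (i, i))" for \<omega>
  have X: "X \<omega> \<in> carrier_mat n n" "(X \<omega>)\<^sup>T = X \<omega>" for \<omega>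
    by (auto simp: X_def insert_commute intro!: eq_matI)
  have "measure_pmf.expectation P trace
    = (\<Sum>i<n. measure_pmf.expectation P (\<lambda>\<omega>. (X \<omega> ^\<^sub>m ?l) $$ (i, i)))"
    by (simp add: trace_def[abs_def])
  also have "\<dots> \<le> (\<Sum>i<n. (2 * \<sigma> + 3 * (real ?l)\<^sup>2) ^ ?l)"
    using k by (intro sum_mono expectation_pow_diag_le) auto
  finally have "1 - real n * ((2 * \<sigma> + 3 * (real ?l)\<^sup>2) / \<rho>) ^ ?l
    \<le> 1 - measure_pmf.expectation P trace / \<rho> ^ ?l"
    using \<rho> by (simp add: power_divide divide_right_mono)
  also have "\<dots> \<le> measure_pmf.prob P {\<omega>. trace \<omega> < \<rho> ^ ?l}"
    using \<rho> trace_pow_even_nonneg[OF X]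
    by (intro prob_less_ge_Markov finite_support) (auto simp: trace_def)
  also have "\<dots> \<le> measure_pmf.prob P {\<omega>. \<forall>x. \<bar>quad_form (X \<omega>) x\<bar> \<le> \<rho> * (\<Sum>i<n. (x i)\<^sup>2)}"
    using quad_form_le_of_trace_pow_le[OF X _ k] \<rho>
    by (intro measure_pmf.finite_measure_mono) (auto simp: trace_def)
  finally show ?thesis .
qed

end

section \<open>Products of probability distributions\<close>

lemma expectation_prod_Pi_pmf_subset:
  fixes f :: "'a \<Rightarrow> 'b \<Rightarrow> real"
  assumes I: "finite I" and S: "S \<subseteq> I" and int: "\<And>x. x \<in> S \<Longrightarrow> integrable (measure_pmf (p x)) (f x)"
  shows "measure_pmf.expectation (Pi_pmf I dflt p) (\<lambda>y. \<Prod>x\<in>S. f x (y x))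
    = (\<Prod>x\<in>S. measure_pmf.expectation (p x) (f x))"
proof -
  let ?P = "Pi_pmf I dflt p"
  note prob_space = measure_pmf.prob_space_axioms
  have comp: "map_pmf (\<lambda>y. y x) ?P = p x" if "x \<in> S" for x
    using S that by (subst Pi_pmf_component[OF I]) auto
  have "prob_space.indep_vars ?P (\<lambda>_. borel) (\<lambda>x y. f x (y x)) I"
    by (rule prob_space.indep_vars_compose2[OF prob_space indep_vars_Pi_pmf[OF I]]) simp
  hence "prob_space.indep_vars ?P (\<lambda>_. borel) (\<lambda>x y. f x (y x)) S"
    using S by (rule prob_space.indep_vars_subset[OF prob_space])
  moreover have "integrable (measure_pmf ?P) (\<lambda>y. f x (y x))" if "x \<in> S" for x
    using int[OF that] unfolding comp[OF that, symmetric] by simp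
  ultimately have "measure_pmf.expectation ?P (\<lambda>y. \<Prod>x\<in>S. f x (y x))
      = (\<Prod>x\<in>S. measure_pmf.expectation ?P (\<lambda>y. f x (y x)))"
    using finite_subset[OF S I] by (intro prob_space.indep_vars_lebesgue_integral prob_space) auto
  also have "\<dots> = (\<Prod>x\<in>S. measure_pmf.expectation (p x) (f x))"
    by (intro prod.cong refl) (simp flip: comp)
  finally show ?thesis .
qed

lemma indep_var_Pi_pmf:
  fixes g h :: "('a \<Rightarrow> 'b::countable) \<Rightarrow> real"
  assumes I: "finite I" and AB: "A \<subseteq> I" "B \<subseteq> I" "A \<inter> B = {}"
    and g: "\<And>f f'. (\<And>x. x \<in> A \<Longrightarrow> f x = f' x) \<Longrightarrow> g f = g f'"
    and h: "\<And>f f'. (\<And>x. x \<in> B \<Longrightarrow> f x = f' x) \<Longrightarrow> h f = h f'"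
  shows "prob_space.indep_var (Pi_pmf I dflt p) borel g borel h"
proof -
  note prob_space = measure_pmf.prob_space_axioms
  let ?M = "\<lambda>J. \<Pi>\<^sub>M i\<in>J. (count_space UNIV :: 'b measure)"
  have restr: "prob_space.indep_var (Pi_pmf I dflt p)
      (?M A) (\<lambda>f. restrict f A) (?M B) (\<lambda>f. restrict f B)"
    by (rule prob_space.indep_var_restrict[OF prob_space indep_vars_Pi_pmf[OF I] AB(3,1,2)])
  have meas: "u \<in> ?M J \<rightarrow>\<^sub>M borel" if "J \<subseteq> I" for J and u :: "('a \<Rightarrow> 'b) \<Rightarrow> real"
    using finite_subset[OF that I] by (simp add: count_space_PiM_finite)
  have "g = g \<circ> (\<lambda>f. restrict f A)" "h = h \<circ> (\<lambda>f. restrict f B)"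
    by (auto simp: fun_eq_iff intro!: g h)
  thus ?thesis
    using prob_space.indep_var_compose[OF prob_space restr meas[OF AB(1)] meas[OF AB(2)], of g h]
    by simp
qed

lemma variance_sum_uncorrelated:
  fixes Y :: "'b \<Rightarrow> 'a \<Rightarrow> real"
  assumes fin: "finite (set_pmf P)" and J: "finite J"
    and uncorrelated: "\<And>j l. j \<in> J \<Longrightarrow> l \<in> J \<Longrightarrow> j \<noteq> l \<Longrightarrow>
       measure_pmf.expectation P (\<lambda>\<omega>. Y j \<omega> * Y l \<omega>)
         = measure_pmf.expectation P (Y j) * measure_pmf.expectation P (Y l)"
  shows "measure_pmf.variance P (\<lambda>\<omega>. \<Sum>j\<in>J. Y j \<omega>) = (\<Sum>j\<in>J. measure_pmf.variance P (Y j))"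
proof -
  let ?E = "measure_pmf.expectation P"
  have int [simp]: "integrable (measure_pmf P) g" for g :: "'a \<Rightarrow> real"
    by (rule integrable_measure_pmf_finite[OF fin])
  define Z where "Z j \<omega> = Y j \<omega> - ?E (Y j)" for j \<omega>
  have cov: "?E (\<lambda>\<omega>. Z j \<omega> * Z l \<omega>) = ?E (\<lambda>\<omega>. Y j \<omega> * Y l \<omega>) - ?E (Y j) * ?E (Y l)" for j l
    by (simp add: Z_def algebra_simps)
  have "measure_pmf.variance P (\<lambda>\<omega>. \<Sum>j\<in>J. Y j \<omega>) = (\<Sum>j\<in>J. \<Sum>l\<in>J. ?E (\<lambda>\<omega>. Z j \<omega> * Z l \<omega>))"
    by (simp add: Z_def power2_eq_square sum_product flip: sum_subtractf)
  also have "\<dots> = (\<Sum>j\<in>J. \<Sum>l\<in>J. if l = j then ?E (\<lambda>\<omega>. (Z j \<omega>)\<^sup>2) else 0)"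
    using uncorrelated by (intro sum.cong refl) (auto simp: cov power2_eq_square)
  also have "\<dots> = (\<Sum>j\<in>J. measure_pmf.variance P (Y j))"
    using J by (simp add: Z_def)
  finally show ?thesis .
qed

lemma exp_minus_le_quadratic:
  fixes x :: real
  assumes "x \<ge> 0"
  shows "exp (- x) \<le> 1 - x + x\<^sup>2 / 2"
proof -
  have "(1 + x + x\<^sup>2 / 2) * (1 - x + x\<^sup>2 / 2) = 1 + (x\<^sup>2)\<^sup>2 / 4"
    by (simp add: field_simps power2_eq_square)
  hence "1 \<le> (1 + x + x\<^sup>2 / 2) * (1 - x + x\<^sup>2 / 2)" by simp
  also have "\<dots> \<le> exp x * (1 - x + x\<^sup>2 / 2)"
  proof (intro mult_right_mono exp_lower_Taylor_quadratic assms)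
    have "0 \<le> (1 - x)\<^sup>2" by simp
    thus "0 \<le> 1 - x + x\<^sup>2 / 2" by (simp add: power2_eq_square algebra_simps)
  qed
  finally show ?thesis by (simp add: exp_minus field_simps)
qed

text \<open>The exponential moment method with parameter \<open>\<delta>\<close> instead of the optimal \<open>- ln (1 - \<delta>)\<close>.\<close>
lemma prob_sum_bernoulli_ge_Chernoff:
  fixes p :: "'a \<Rightarrow> real"
  assumes I: "finite I" and S: "S \<subseteq> I" and p: "\<And>x. x \<in> S \<Longrightarrow> 0 \<le> p x \<and> p x \<le> 1" and \<delta>: "\<delta> \<ge> 0"
  defines "\<mu> \<equiv> \<Sum>x\<in>S. p x"
  shows "measure_pmf.prob (Pi_pmf I dflt (\<lambda>x. bernoulli_pmf (p x)))
      {f. (\<Sum>x\<in>S. of_bool (f x)) > (1 - \<delta>) * \<mu>} \<ge> 1 - exp (- (\<delta>\<^sup>2 * \<mu> / 2))"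
proof -
  let ?P = "Pi_pmf I dflt (\<lambda>x. bernoulli_pmf (p x))"
  define u where "u f = (\<Prod>x\<in>S. exp (- \<delta> * of_bool (f x)))" for f :: "'a \<Rightarrow> bool"
  have u: "u f = exp (- \<delta> * (\<Sum>x\<in>S. of_bool (f x)))" for f
    using finite_subset[OF S I] unfolding u_def
    by (simp add: sum_distrib_left exp_sum del: sum_of_bool_eq)
  have fin: "finite (set_pmf ?P)"
    using I by (simp add: set_Pi_pmf finite_PiE_dflt)
  have "measure_pmf.expectation ?P u
      = (\<Prod>x\<in>S. measure_pmf.expectation (bernoulli_pmf (p x)) (\<lambda>b. exp (- \<delta> * of_bool b)))"
    unfolding u_def using I S
    by (intro expectation_prod_Pi_pmf_subset) (auto intro: integrable_measure_pmf_finite)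
  also have "\<dots> = (\<Prod>x\<in>S. 1 + p x * (exp (- \<delta>) - 1))"
    using p by (intro prod.cong) (auto simp: algebra_simps)
  also have "\<dots> \<le> (\<Prod>x\<in>S. exp (p x * (- \<delta> + \<delta>\<^sup>2 / 2)))"
  proof (intro prod_mono conjI)
    fix x assume x: "x \<in> S"
    have "0 \<le> p x * exp (- \<delta>) + (1 - p x)" using p[OF x] by simp
    thus "0 \<le> 1 + p x * (exp (- \<delta>) - 1)" by (simp add: algebra_simps)
    have "p x * (exp (- \<delta>) - 1) \<le> p x * (- \<delta> + \<delta>\<^sup>2 / 2)"
      using exp_minus_le_quadratic[OF \<delta>] p[OF x] by (intro mult_left_mono) auto
    also have "1 + \<dots> \<le> exp \<dots>" by (rule exp_ge_add_one_self)
    finally show "1 + p x * (exp (- \<delta>) - 1) \<le> exp (p x * (- \<delta> + \<delta>\<^sup>2 / 2))" by simp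
  qed
  also have "\<dots> = exp (\<mu> * (- \<delta> + \<delta>\<^sup>2 / 2))"
    using finite_subset[OF S I] by (simp add: \<mu>_def sum_distrib_right exp_sum)
  finally have "measure_pmf.expectation ?P u / exp (- \<delta> * ((1 - \<delta>) * \<mu>))
      \<le> exp (\<mu> * (- \<delta> + \<delta>\<^sup>2 / 2)) / exp (- \<delta> * ((1 - \<delta>) * \<mu>))"
    by (intro divide_right_mono) auto
  also have "\<dots> = exp (- (\<delta>\<^sup>2 * \<mu> / 2))"
    by (simp add: power2_eq_square algebra_simps flip: exp_diff)
  finally have "1 - exp (- (\<delta>\<^sup>2 * \<mu> / 2))
    \<le> 1 - measure_pmf.expectation ?P u / exp (- \<delta> * ((1 - \<delta>) * \<mu>))"
    by simp
  also have "\<dots> \<le> measure_pmf.prob ?P {f. u f < exp (- \<delta> * ((1 - \<delta>) * \<mu>))}"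
    using fin by (intro prob_less_ge_Markov) (auto simp: u)
  also have "\<dots> \<le> measure_pmf.prob ?P {f. (\<Sum>x\<in>S. of_bool (f x)) > (1 - \<delta>) * \<mu>}"
    using \<delta> by (intro measure_pmf.finite_measure_mono) (auto simp: u mult_less_cancel_left)
  finally show ?thesis .
qed

section \<open>Spectra of bipartite graphs\<close>

definition bip_edges :: "nat \<Rightarrow> nat \<Rightarrow> (nat \<times> nat \<Rightarrow> bool) \<Rightarrow> nat set set" where
  "bip_edges n1 n2 f = {{i, n1 + j} | i j. i < n1 \<and> j < n2 \<and> f (i, j)}"

definition left_degree :: "nat \<Rightarrow> (nat \<times> nat \<Rightarrow> bool) \<Rightarrow> nat \<Rightarrow> real" where
  "left_degree n2 f i = (\<Sum>j<n2. of_bool (f (i, j)))"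

definition right_degree :: "nat \<Rightarrow> (nat \<times> nat \<Rightarrow> bool) \<Rightarrow> nat \<Rightarrow> real" where
  "right_degree n1 f j = (\<Sum>i<n1. of_bool (f (i, j)))"

definition centred_biadjacency :: "nat \<Rightarrow> nat \<Rightarrow> real \<Rightarrow> (nat \<times> nat \<Rightarrow> bool) \<Rightarrow> real mat" where
  "centred_biadjacency n1 n2 p f = Matrix.mat n1 n2 (\<lambda>ij. of_bool (f ij) - p)"

lemma dim_centred_biadjacency [simp]:
  "dim_row (centred_biadjacency n1 n2 p f) = n1" "dim_col (centred_biadjacency n1 n2 p f) = n2"
  by (simp_all add: centred_biadjacency_def)

definition laplacian_deviation :: "nat \<Rightarrow> nat set set \<Rightarrow> real" where
  "laplacian_deviation n E = Max ((\<lambda>i. \<bar>mu_graph i n E - 1\<bar>) ` ({1..n} - {1, n}))"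

lemma bip_edges_iff: "i < n1 \<Longrightarrow> j < n2 \<Longrightarrow> {i, n1 + j} \<in> bip_edges n1 n2 f \<longleftrightarrow> f (i, j)"
  by (auto simp: bip_edges_def doubleton_eq_iff)

lemma bip_edges_same_side: "(u < n1 \<longleftrightarrow> v < n1) \<Longrightarrow> {u, v} \<notin> bip_edges n1 n2 f"
  by (auto simp: bip_edges_def doubleton_eq_iff)

lemma right_degree_nonneg: "right_degree n1 f j \<ge> 0"
  by (simp add: right_degree_def)

lemma vertex_degree_left:
  assumes "i < n1"
  shows "real (vertex_degree (bip_edges n1 n2 f) i) = left_degree n2 f i"
proof -
  have "{e \<in> bip_edges n1 n2 f. i \<in> e} = (\<lambda>j. {i, n1 + j}) ` {j \<in> {..<n2}. f (i, j)}"
    using assms by (auto simp: bip_edges_def)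
  moreover have "inj_on (\<lambda>j. {i, n1 + j}) {j \<in> {..<n2}. f (i, j)}"
    by (auto simp: inj_on_def doubleton_eq_iff)
  ultimately show ?thesis
    by (simp add: vertex_degree_def card_image left_degree_def sum_of_bool_eq Int_def)
qed

lemma vertex_degree_right:
  assumes "j < n2"
  shows "real (vertex_degree (bip_edges n1 n2 f) (n1 + j)) = right_degree n1 f j"
proof -
  have "{e \<in> bip_edges n1 n2 f. n1 + j \<in> e} = (\<lambda>i. {i, n1 + j}) ` {i \<in> {..<n1}. f (i, j)}"
    using assms by (auto simp: bip_edges_def)
  moreover have "inj_on (\<lambda>i. {i, n1 + j}) {i \<in> {..<n1}. f (i, j)}"
    by (auto simp: inj_on_def doubleton_eq_iff)
  ultimately show ?thesis
    by (simp add: vertex_degree_def card_image right_degree_def sum_of_bool_eq Int_def)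
qed

lemma adjacency_matrix_carrier: "adjacency_matrix n E \<in> carrier_mat n n"
  by (simp add: adjacency_matrix_def)

lemma adjacency_matrix_symmetric: "(adjacency_matrix n E)\<^sup>T = adjacency_matrix n E"
  by (auto simp: adjacency_matrix_def insert_commute intro!: eq_matI)

lemma mu_adjacency_near_0:
  assumes "spectral_norm_le (centred_biadjacency n1 n2 p f) \<rho>" "\<rho> \<ge> 0" "1 < k" "k < n1 + n2"
  shows "\<bar>mu k (adjacency_matrix (n1 + n2) (bip_edges n1 n2 f))\<bar> \<le> \<rho>"
proof -
  let ?A = "adjacency_matrix (n1 + n2) (bip_edges n1 n2 f)"
  have norm: "spectral_norm_le (Matrix.mat n1 n2 (\<lambda>(i, j). ?A $$ (i, n1 + j) - p * 1)) \<rho>"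
  proof -
    have "Matrix.mat n1 n2 (\<lambda>(i, j). ?A $$ (i, n1 + j) - p * 1) = centred_biadjacency n1 n2 p f"
      by (auto simp: adjacency_matrix_def centred_biadjacency_def bip_edges_iff intro!: eq_matI)
    thus ?thesis using assms(1) by simp
  qed
  have "\<bar>mu k ?A - 0\<bar> \<le> \<rho>"
  proof (rule mu_block_near[OF adjacency_matrix_carrier adjacency_matrix_symmetric _ norm
        assms(2-4)])
    show "?A $$ (u, v) = 0 * of_bool (u = v)"
      if "u < n1 + n2" "v < n1 + n2" "u < n1 \<longleftrightarrow> v < n1" for u v
      using that by (simp add: adjacency_matrix_def bip_edges_same_side)
  qed
  thus ?thesis by simp
qed

lemma normalized_laplacian_index:
  assumes "u < n" "v < n"
  shows "normalized_laplacian n E $$ (u, v) = of_bool (u = v)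
    - of_bool ({u, v} \<in> E) / (sqrt (real (vertex_degree E u)) * sqrt (real (vertex_degree E v)))"
proof -
  let ?s = "\<lambda>v. 1 / sqrt (real (vertex_degree E v))"
  have "mat_diag n ?s * adjacency_matrix n E * mat_diag n ?s
      = Matrix.mat n n (\<lambda>(i, j). ?s i * adjacency_matrix n E $$ (i, j) * ?s j)"
    using adjacency_matrix_carrier[of n E]
    by (simp add: mat_diag_mult_left mat_diag_mult_right[of _ n]) (auto intro!: eq_matI)
  thus ?thesis
    using assms
    by (simp add: normalized_laplacian_def inv_sqrt_degree_matrix_def adjacency_matrix_def)
qed

lemma normalized_laplacian_carrier: "normalized_laplacian n E \<in> carrier_mat n n"
  unfolding normalized_laplacian_def inv_sqrt_degree_matrix_def adjacency_matrix_def
  by (intro minus_carrier_mat mult_carrier_mat) auto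

lemma normalized_laplacian_symmetric: "(normalized_laplacian n E)\<^sup>T = normalized_laplacian n E"
  using normalized_laplacian_carrier[of n E]
  by (intro eq_matI) (auto simp: normalized_laplacian_index insert_commute mult.commute)

lemma mu_graph_near_1:
  assumes norm: "spectral_norm_le (Matrix.mat n1 n2 (\<lambda>(i, j). of_bool (f (i, j))
        / (sqrt (left_degree n2 f i) * sqrt (right_degree n1 f j)) - a i * b j)) \<beta>"
      (is "spectral_norm_le ?B \<beta>")
    and \<beta>: "\<beta> \<ge> 0" and k: "1 < k" "k < n1 + n2"
  shows "\<bar>mu_graph k (n1 + n2) (bip_edges n1 n2 f) - 1\<bar> \<le> \<beta>"
proof -
  let ?E = "bip_edges n1 n2 f"
  let ?L = "normalized_laplacian (n1 + n2) ?E"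
  have "Matrix.mat n1 n2 (\<lambda>(i, j). ?L $$ (i, n1 + j) - (- a i) * b j) = - ?B"
    by (auto simp: normalized_laplacian_index bip_edges_iff vertex_degree_left vertex_degree_right
      intro!: eq_matI)
  hence "spectral_norm_le (Matrix.mat n1 n2 (\<lambda>(i, j). ?L $$ (i, n1 + j) - (- a i) * b j)) \<beta>"
    using norm by (simp only: spectral_norm_le_uminus)
  moreover have "?L $$ (u, v) = 1 * of_bool (u = v)"
    if "u < n1 + n2" "v < n1 + n2" "u < n1 \<longleftrightarrow> v < n1" for u v
    using that by (simp add: normalized_laplacian_index bip_edges_same_side)
  ultimately show ?thesis
    unfolding mu_graph_def using \<beta> k
    by (intro mu_block_near[OF normalized_laplacian_carrier normalized_laplacian_symmetric])
qed

lemma laplacian_deviation_le: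
  assumes "n \<ge> 3" "\<And>k. 1 < k \<Longrightarrow> k < n \<Longrightarrow> \<bar>mu_graph k n E - 1\<bar> \<le> \<beta>"
  shows "laplacian_deviation n E \<le> \<beta>"
  unfolding laplacian_deviation_def
proof (rule Max.boundedI)
  have "2 \<in> {1..n} - {1, n}" using assms(1) by auto
  thus "(\<lambda>i. \<bar>mu_graph i n E - 1\<bar>) ` ({1..n} - {1, n}) \<noteq> {}" by blast
  fix a assume "a \<in> (\<lambda>i. \<bar>mu_graph i n E - 1\<bar>) ` ({1..n} - {1, n})"
  then obtain k where k: "a = \<bar>mu_graph k n E - 1\<bar>" "k \<in> {1..n} - {1, n}" by blast
  hence "1 < k" "k < n" by auto
  thus "a \<le> \<beta>" using k(1) assms(2) by simp
qed simp

lemma laplacian_deviation_le_of_degrees: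
  assumes n: "n1 + n2 \<ge> 3" and norm: "spectral_norm_le (centred_biadjacency n1 n2 p f) \<rho>"
    and \<rho>: "\<rho> \<ge> 0"
    and left: "\<And>i. i < n1 \<Longrightarrow> left_degree n2 f i \<ge> \<delta>1" "\<delta>1 > 0"
    and right: "\<And>j. j < n2 \<Longrightarrow> right_degree n1 f j \<ge> \<delta>2" "\<delta>2 > 0"
  shows "laplacian_deviation (n1 + n2) (bip_edges n1 n2 f) \<le> \<rho> / (sqrt \<delta>1 * sqrt \<delta>2)"
proof (intro laplacian_deviation_le n mu_graph_near_1)
  let ?r = "\<lambda>i. 1 / sqrt (left_degree n2 f i)" and ?s = "\<lambda>j. 1 / sqrt (right_degree n1 f j)"
  have "spectral_norm_le (Matrix.mat n1 n2
      (\<lambda>(i, j). ?r i * centred_biadjacency n1 n2 p f $$ (i, j) * ?s j))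
      (1 / sqrt \<delta>1 * \<rho> * (1 / sqrt \<delta>2))"
  proof (rule spectral_norm_le_scale[OF norm \<rho>, unfolded dim_centred_biadjacency])
    have inv_sqrt: "\<bar>1 / sqrt x\<bar> \<le> 1 / sqrt \<delta>" if "x \<ge> \<delta>" "\<delta> > 0" for x \<delta> :: real
      using that by (auto intro!: divide_left_mono)
    show "\<bar>?r i\<bar> \<le> 1 / sqrt \<delta>1" if "i < n1" for i using left that by (intro inv_sqrt)
    show "\<bar>?s j\<bar> \<le> 1 / sqrt \<delta>2" if "j < n2" for j using right that by (intro inv_sqrt)
  qed (use left(2) right(2) in auto)
  also have "Matrix.mat n1 n2 (\<lambda>(i, j). ?r i * centred_biadjacency n1 n2 p f $$ (i, j) * ?s j)
      = Matrix.mat n1 n2 (\<lambda>(i, j). of_bool (f (i, j))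
        / (sqrt (left_degree n2 f i) * sqrt (right_degree n1 f j))
        - p * ?r i * ?s j)"
    by (intro eq_matI) (auto simp: centred_biadjacency_def diff_divide_distrib)
  finally show "spectral_norm_le (Matrix.mat n1 n2 (\<lambda>(i, j). of_bool (f (i, j))
      / (sqrt (left_degree n2 f i) * sqrt (right_degree n1 f j)) - p * ?r i * ?s j))
      (\<rho> / (sqrt \<delta>1 * sqrt \<delta>2))"
    by (simp add: mult_ac)
qed (use \<rho> left(2) right(2) in auto)

text \<open>If column \<open>j\<close> vanishes, then so does the projection, because \<open>x / 0 = 0\<close>.\<close>
definition column_projection :: "nat \<Rightarrow> (nat \<times> nat \<Rightarrow> bool) \<Rightarrow> nat \<Rightarrow> real mat" where
  "column_projection n1 f j =
     Matrix.mat n1 n1 (\<lambda>(i, k). of_bool (f (i, j)) * of_bool (f (k, j)) / right_degree n1 f j)"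

definition two_step_matrix :: "nat \<Rightarrow> nat \<Rightarrow> (nat \<times> nat \<Rightarrow> bool) \<Rightarrow> real mat" where
  "two_step_matrix n1 n2 f = Matrix.mat n1 n1 (\<lambda>ik. \<Sum>j<n2. column_projection n1 f j $$ ik)"

lemma quad_form_two_step_matrix:
  "quad_form (two_step_matrix n1 n2 f) z
    = (\<Sum>j<n2. (\<Sum>i<n1. of_bool (f (i, j)) * z i)\<^sup>2 / right_degree n1 f j)"
proof -
  have "quad_form (two_step_matrix n1 n2 f) z
      = (\<Sum>i<n1. \<Sum>k<n1. \<Sum>j<n2.
        of_bool (f (i, j)) * of_bool (f (k, j)) / right_degree n1 f j * z i * z k)"
    by (simp add: bilinear_form_def two_step_matrix_def column_projection_def sum_distrib_right)
  also have "\<dots> = (\<Sum>i<n1. \<Sum>j<n2. \<Sum>k<n1.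
      of_bool (f (i, j)) * of_bool (f (k, j)) / right_degree n1 f j * z i * z k)"
    by (intro sum.cong refl sum.swap)
  also have "\<dots> = (\<Sum>j<n2. \<Sum>i<n1. \<Sum>k<n1.
      of_bool (f (i, j)) * of_bool (f (k, j)) / right_degree n1 f j * z i * z k)"
    by (rule sum.swap)
  also have "\<dots> = (\<Sum>j<n2. (\<Sum>i<n1. of_bool (f (i, j)) * z i)\<^sup>2 / right_degree n1 f j)"
    unfolding power2_eq_square sum_product sum_divide_distrib by (intro sum.cong refl) simp
  finally show ?thesis .
qed

lemma sum_square_deviation_le:
  fixes u :: "'a \<Rightarrow> real"
  assumes "finite A" "A \<noteq> {}"
  shows "(\<Sum>i\<in>A. (u i - (\<Sum>i\<in>A. u i) / card A)\<^sup>2) \<le> (\<Sum>i\<in>A. (u i)\<^sup>2)"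
proof -
  define c where "c = (\<Sum>i\<in>A. u i) / card A"
  have c: "(\<Sum>i\<in>A. u i) = card A * c" using assms by (simp add: c_def)
  have "(\<Sum>i\<in>A. (u i - c)\<^sup>2) = (\<Sum>i\<in>A. (u i)\<^sup>2 - 2 * c * u i + c\<^sup>2)"
    by (simp add: power2_diff algebra_simps)
  also have "\<dots> = (\<Sum>i\<in>A. (u i)\<^sup>2) - 2 * c * (\<Sum>i\<in>A. u i) + card A * c\<^sup>2"
    by (simp add: sum.distrib sum_subtractf sum_distrib_left)
  also have "\<dots> = (\<Sum>i\<in>A. (u i)\<^sup>2) - card A * c\<^sup>2" unfolding c by (simp add: power2_eq_square)
  finally show ?thesis by (simp add: c_def)
qed

lemma sum_centred_normalized_column:
  fixes f :: "nat \<times> nat \<Rightarrow> bool" and n1 :: nat and r :: "nat \<Rightarrow> real"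
  defines "s j \<equiv> sqrt (right_degree n1 f j)"
  shows "(\<Sum>i<n1. (of_bool (f (i, j)) / (r i * s j) - 1 / (real n1 * r i) * s j) * x i)
    = (\<Sum>i<n1. of_bool (f (i, j)) * (x i / r i - (\<Sum>k<n1. x k / r k) / n1)) / s j"
proof -
  define c where "c = (\<Sum>k<n1. x k / r k) / n1"
  have "(of_bool (f (i, j)) / (r i * s j) - 1 / (real n1 * r i) * s j) * x i
      = of_bool (f (i, j)) * (x i / r i) / s j - x i / r i / real n1 * s j" for i
    by (cases "f (i, j)") (simp_all add: right_diff_distrib mult.commute)
  hence "(\<Sum>i<n1. (of_bool (f (i, j)) / (r i * s j) - 1 / (real n1 * r i) * s j) * x i)
      = (\<Sum>i<n1. of_bool (f (i, j)) * (x i / r i) / s j) - c * s j"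
    by (simp only: c_def sum_subtractf sum_divide_distrib sum_distrib_right)
  also have "\<dots> = (\<Sum>i<n1. of_bool (f (i, j)) * (x i / r i) / s j) - c * (right_degree n1 f j / s j)"
    by (simp only: s_def real_div_sqrt right_degree_nonneg)
  also have "\<dots> = (\<Sum>i<n1. of_bool (f (i, j)) * (x i / r i) - c * of_bool (f (i, j))) / s j"
    by (simp only: right_degree_def sum_subtractf sum_distrib_left diff_divide_distrib
        sum_divide_distrib times_divide_eq_right)
  also have "\<dots> = (\<Sum>i<n1. of_bool (f (i, j)) * (x i / r i - c)) / s j"
    by (simp only: right_diff_distrib mult.commute)
  finally show ?thesis unfolding c_def .
qed

lemma quad_form_two_step_centred_le:
  fixes x :: "nat \<Rightarrow> real"
  assumes n: "n1 > 0" and \<kappa>: "\<kappa> \<ge> 0"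
    and left: "\<And>i. i < n1 \<Longrightarrow> left_degree n2 f i \<ge> \<delta>" "\<delta> > 0"
    and two_step: "\<And>z. (\<Sum>i<n1. z i) = 0 \<Longrightarrow>
      quad_form (two_step_matrix n1 n2 f) z \<le> \<kappa> * (\<Sum>i<n1. (z i)\<^sup>2)"
  defines "u \<equiv> \<lambda>i. x i / sqrt (left_degree n2 f i)"
  shows "quad_form (two_step_matrix n1 n2 f) (\<lambda>i. u i - (\<Sum>k<n1. u k) / n1)
    \<le> \<kappa> / \<delta> * (\<Sum>i<n1. (x i)\<^sup>2)"
proof -
  have "quad_form (two_step_matrix n1 n2 f) (\<lambda>i. u i - (\<Sum>k<n1. u k) / n1)
      \<le> \<kappa> * (\<Sum>i<n1. (u i - (\<Sum>k<n1. u k) / n1)\<^sup>2)"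
    using n by (intro two_step) (simp add: sum_subtractf)
  also have "\<dots> \<le> \<kappa> * (\<Sum>i<n1. (u i)\<^sup>2)"
    using \<kappa> n sum_square_deviation_le[of "{..<n1}" u] by (intro mult_left_mono) auto
  also have "\<dots> \<le> \<kappa> * (\<Sum>i<n1. (x i)\<^sup>2 / \<delta>)"
  proof (intro mult_left_mono sum_mono)
    fix i assume "i \<in> {..<n1}"
    hence degree: "left_degree n2 f i \<ge> \<delta>" using left by simp
    hence "(u i)\<^sup>2 = (x i)\<^sup>2 / left_degree n2 f i" using left(2) by (simp add: u_def power_divide)
    also have "\<dots> \<le> (x i)\<^sup>2 / \<delta>" using degree left(2) by (intro divide_left_mono) auto
    finally show "(u i)\<^sup>2 \<le> (x i)\<^sup>2 / \<delta>" .
  qed (rule \<kappa>)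
  also have "\<dots> = \<kappa> / \<delta> * (\<Sum>i<n1. (x i)\<^sup>2)" by (simp flip: sum_divide_distrib)
  finally show ?thesis .
qed

text \<open>The rank-one part is that of the expected matrix, except that the left factor pairs with \<open>x\<close>
  to the exact mean of \<open>x i / sqrt (left_degree n2 f i)\<close>. No concentration of the right degrees is
  needed.\<close>
lemma spectral_norm_le_of_two_step:
  fixes f :: "nat \<times> nat \<Rightarrow> bool" and n1 n2 :: nat
  assumes n: "n1 > 0" and \<kappa>: "\<kappa> \<ge> 0"
    and left: "\<And>i. i < n1 \<Longrightarrow> left_degree n2 f i \<ge> \<delta>" "\<delta> > 0"
    and two_step: "\<And>z. (\<Sum>i<n1. z i) = 0 \<Longrightarrow>
      quad_form (two_step_matrix n1 n2 f) z \<le> \<kappa> * (\<Sum>i<n1. (z i)\<^sup>2)"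
  defines "r i \<equiv> sqrt (left_degree n2 f i)" and "s j \<equiv> sqrt (right_degree n1 f j)"
  shows "spectral_norm_le (Matrix.mat n1 n2 (\<lambda>(i, j). of_bool (f (i, j)) / (r i * s j)
    - 1 / (real n1 * r i) * s j)) (sqrt (\<kappa> / \<delta>))" (is "spectral_norm_le ?B _")
  unfolding spectral_norm_le_def dim_row_mat dim_col_mat
proof (intro allI)
  fix x y
  define z where "z i = x i / r i - (\<Sum>k<n1. x k / r k) / n1" for i
  define h where "h j = (\<Sum>i<n1. of_bool (f (i, j)) * z i) / s j" for j
  have "(\<Sum>j<n2. (h j)\<^sup>2) = quad_form (two_step_matrix n1 n2 f) z"
    by (simp add: quad_form_two_step_matrix h_def s_def power_divide right_degree_nonneg)
  also have "\<dots> \<le> \<kappa> / \<delta> * (\<Sum>i<n1. (x i)\<^sup>2)"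
    unfolding z_def r_def by (rule quad_form_two_step_centred_le[OF n \<kappa> left two_step])
  finally have h_le: "L2_set h {..<n2} \<le> sqrt (\<kappa> / \<delta>) * L2_set x {..<n1}"
    unfolding L2_set_def by (simp flip: real_sqrt_mult)
  have column: "(\<Sum>i<n1. ?B $$ (i, j) * x i) = h j" if "j < n2" for j
  proof -
    have "(\<Sum>i<n1. ?B $$ (i, j) * x i)
        = (\<Sum>i<n1. (of_bool (f (i, j)) / (r i * s j) - 1 / (real n1 * r i) * s j) * x i)"
      using that by (intro sum.cong refl) simp
    also have "\<dots> = h j"
      unfolding h_def z_def s_def by (rule sum_centred_normalized_column)
    finally show ?thesis .
  qed
  have "bilinear_form ?B x y = (\<Sum>j<n2. (\<Sum>i<n1. ?B $$ (i, j) * x i) * y j)"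
    unfolding bilinear_form_def sum_distrib_right dim_row_mat dim_col_mat by (rule sum.swap)
  also have "\<dots> = (\<Sum>j<n2. h j * y j)"
    using column by (intro sum.cong) (auto simp del: index_mat)
  finally have "\<bar>bilinear_form ?B x y\<bar> \<le> (\<Sum>j<n2. \<bar>h j\<bar> * \<bar>y j\<bar>)"
    using sum_abs[of "\<lambda>j. h j * y j" "{..<n2}"] by (simp add: abs_mult)
  also have "\<dots> \<le> L2_set h {..<n2} * L2_set y {..<n2}" by (rule L2_set_mult_ineq)
  also have "\<dots> \<le> sqrt (\<kappa> / \<delta>) * L2_set x {..<n1} * L2_set y {..<n2}"
    by (rule mult_right_mono[OF h_le L2_set_nonneg])
  finally show "\<bar>bilinear_form ?B x y\<bar> \<le> sqrt (\<kappa> / \<delta>) * L2_set x {..<n1} * L2_set y {..<n2}" .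
qed

lemma laplacian_deviation_le_of_two_step:
  assumes n: "n1 + n2 \<ge> 3" "n1 > 0" and \<kappa>: "\<kappa> \<ge> 0"
    and left: "\<And>i. i < n1 \<Longrightarrow> left_degree n2 f i \<ge> \<delta>" "\<delta> > 0"
    and two_step: "\<And>z. (\<Sum>i<n1. z i) = 0 \<Longrightarrow>
      quad_form (two_step_matrix n1 n2 f) z \<le> \<kappa> * (\<Sum>i<n1. (z i)\<^sup>2)"
  shows "laplacian_deviation (n1 + n2) (bip_edges n1 n2 f) \<le> sqrt (\<kappa> / \<delta>)"
proof (rule laplacian_deviation_le[OF n(1)])
  fix k assume "1 < k" "k < n1 + n2"
  moreover have "sqrt (\<kappa> / \<delta>) \<ge> 0" using \<kappa> left(2) by simp
  ultimately show "\<bar>mu_graph k (n1 + n2) (bip_edges n1 n2 f) - 1\<bar> \<le> sqrt (\<kappa> / \<delta>)"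
    by (intro mu_graph_near_1[OF spectral_norm_le_of_two_step[OF n(2) \<kappa> left two_step]])
qed

section \<open>The random biadjacency matrix\<close>

definition bip_pmf :: "nat \<Rightarrow> nat \<Rightarrow> real \<Rightarrow> (nat \<times> nat \<Rightarrow> bool) pmf" where
  "bip_pmf n1 n2 p = Pi_pmf ({..<n1} \<times> {..<n2}) False (\<lambda>_. bernoulli_pmf p)"

lemma random_bipartite_eq_map_bip_pmf:
  "random_bipartite n1 n2 p = map_pmf (bip_edges n1 n2) (bip_pmf n1 n2 p)"
  by (simp add: random_bipartite_def bip_pmf_def bip_edges_def[abs_def])

lemma finite_set_bip_pmf: "finite (set_pmf (bip_pmf n1 n2 p))"
  by (simp add: bip_pmf_def set_Pi_pmf finite_PiE_dflt)

lemma abs_bernoulli_central_moment_le: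
  assumes p: "0 \<le> p" "p \<le> 1"
  shows "\<bar>measure_pmf.expectation (bernoulli_pmf p) (\<lambda>b. (of_bool b - p) ^ k)\<bar>
     \<le> (if k = 1 then 0 else if k > 0 then p else 1)"
proof -
  have moment: "measure_pmf.expectation (bernoulli_pmf p) (\<lambda>b. (of_bool b - p) ^ k)
    = p * (1 - p) ^ k + (1 - p) * (- p) ^ k"
    using p by simp
  consider "k = 0" | "k = 1" | "k \<ge> 2" by linarith
  thus ?thesis
  proof cases
    assume k: "k \<ge> 2"
    have "\<bar>p * (1 - p) ^ k + (1 - p) * (- p) ^ k\<bar> \<le> p * (1 - p) ^ k + (1 - p) * p ^ k"
      using p by (intro order.trans[OF abs_triangle_ineq]) (auto simp: abs_mult power_abs)
    also have "\<dots> \<le> p * (1 - p) ^ 2 + (1 - p) * p ^ 2"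
      using p k by (intro add_mono mult_left_mono power_decreasing) auto
    also have "\<dots> = p * (1 - p)" by (simp add: power2_eq_square algebra_simps)
    also have "\<dots> \<le> p" using p by (simp add: mult_left_le)
    finally show ?thesis using k moment by simp
  qed (use p in \<open>simp_all add: algebra_simps\<close>)
qed

definition centred_indicator :: "nat \<Rightarrow> nat \<Rightarrow> real \<Rightarrow> nat set \<Rightarrow> (nat \<times> nat \<Rightarrow> bool) \<Rightarrow> real" where
  "centred_indicator n1 n2 p e f = of_bool (e \<in> bip_edges n1 n2 f) - p"

lemma expectation_prod_centred_indicator:
  fixes n1 n2 :: nat
  defines "G \<equiv> bip_edges n1 n2 (\<lambda>_. True)"
  shows "measure_pmf.expectation (bip_pmf n1 n2 p) (\<lambda>f. \<Prod>e\<in>G. centred_indicator n1 n2 p e f ^ m e)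
    = (\<Prod>e\<in>G. measure_pmf.expectation (bernoulli_pmf p) (\<lambda>b. (of_bool b - p) ^ m e))"
proof -
  let ?I = "{..<n1} \<times> {..<n2}" and ?edge = "\<lambda>(i, j). {i, n1 + j}"
  have G: "G = ?edge ` ?I" by (auto simp: G_def bip_edges_def image_iff)
  have inj: "inj_on ?edge ?I" by (auto simp: inj_on_def doubleton_eq_iff)
  have "(\<lambda>f. \<Prod>e\<in>G. centred_indicator n1 n2 p e f ^ m e)
      = (\<lambda>f. \<Prod>x\<in>?I. (of_bool (f x) - p) ^ m (?edge x))"
    unfolding G prod.reindex[OF inj]
    by (auto simp: centred_indicator_def bip_edges_iff intro!: prod.cong)
  hence "measure_pmf.expectation (bip_pmf n1 n2 p) (\<lambda>f. \<Prod>e\<in>G. centred_indicator n1 n2 p e f ^ m e)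
      = (\<Prod>x\<in>?I. measure_pmf.expectation (bernoulli_pmf p) (\<lambda>b. (of_bool b - p) ^ m (?edge x)))"
    unfolding bip_pmf_def
    by (simp only:) (rule expectation_prod_Pi_pmf_subset, auto intro: integrable_measure_pmf_finite)
  also have "\<dots> = (\<Prod>e\<in>G. measure_pmf.expectation (bernoulli_pmf p) (\<lambda>b. (of_bool b - p) ^ m e))"
    unfolding G by (simp add: prod.reindex[OF inj])
  finally show ?thesis .
qed

lemma abs_expectation_prod_centred_indicator_le:
  fixes m :: "nat set \<Rightarrow> nat" and n1 n2 :: nat
  assumes p: "0 \<le> p" "p \<le> 1"
  defines "G \<equiv> bip_edges n1 n2 (\<lambda>_. True)"
  shows "\<bar>measure_pmf.expectation (bip_pmf n1 n2 p) (\<lambda>f. \<Prod>e\<in>G. centred_indicator n1 n2 p e f ^ m e)\<bar>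
    \<le> (if \<exists>e\<in>G. m e = 1 then 0 else p ^ card {e \<in> G. m e > 0})"
proof -
  let ?M = "\<lambda>k. \<bar>measure_pmf.expectation (bernoulli_pmf p) (\<lambda>b. (of_bool b - p) ^ k)\<bar>"
  have finite: "finite G"
    by (rule finite_subset[of _ "Pow {..<n1 + n2}"]) (auto simp: G_def bip_edges_def)
  have moment: "?M k \<le> (if k = 1 then 0 else if k > 0 then p else 1)" for k
    using p by (rule abs_bernoulli_central_moment_le)
  have "\<bar>measure_pmf.expectation (bip_pmf n1 n2 p) (\<lambda>f. \<Prod>e\<in>G. centred_indicator n1 n2 p e f ^ m e)\<bar>
      = (\<Prod>e\<in>G. ?M (m e))"
    unfolding G_def by (simp add: expectation_prod_centred_indicator abs_prod)
  also have "\<dots> \<le> (\<Prod>e\<in>G. if m e = 1 then 0 else if m e > 0 then p else 1)"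
    using moment by (intro prod_mono) auto
  also have "\<dots> = (if \<exists>e\<in>G. m e = 1 then 0 else p ^ card {e \<in> G. m e > 0})"
  proof (cases "\<exists>e\<in>G. m e = 1")
    case True
    thus ?thesis using finite by (auto intro!: prod_zero)
  next
    case False
    hence "(\<Prod>e\<in>G. if m e = 1 then 0 else if m e > 0 then p else 1)
      = (\<Prod>e\<in>G. if m e > 0 then p else 1)"
      by (intro prod.cong) auto
    also have "\<dots> = p ^ card {e \<in> G. m e > 0}" using finite by (simp add: prod.If_cases Int_def)
    finally show ?thesis using False by simp
  qed
  finally show ?thesis .
qed

lemma random_symmetric_matrix_bip_pmf:
  assumes n: "1 \<le> n1" "n1 \<le> n2" and p: "0 < p" "p \<le> 1"
  shows "random_symmetric_matrix (bip_pmf n1 n2 p) (centred_indicator n1 n2 p)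
    (bip_edges n1 n2 (\<lambda>_. True)) (n1 + n2) n2 p"
proof
  let ?G = "bip_edges n1 n2 (\<lambda>_. True)"
  show "\<exists>u v. e = {u, v} \<and> u \<noteq> v \<and> u < n1 + n2 \<and> v < n1 + n2" if "e \<in> ?G" for e
    using that by (fastforce simp: bip_edges_def)
  show "card {v. {u, v} \<in> ?G} \<le> n2" for u
  proof (cases "u < n1")
    case True
    hence "{v. {u, v} \<in> ?G} \<subseteq> {n1..<n1 + n2}" by (auto simp: bip_edges_def doubleton_eq_iff)
    from card_mono[OF _ this] show ?thesis by simp
  next
    case False
    hence "{v. {u, v} \<in> ?G} \<subseteq> {..<n1}" by (auto simp: bip_edges_def doubleton_eq_iff)
    from card_mono[OF _ this] show ?thesis using n by simp
  qed
  show "\<bar>measure_pmf.expectation (bip_pmf n1 n2 p) (\<lambda>f. \<Prod>e\<in>?G. centred_indicator n1 n2 p e f ^ m e)\<bar>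
      \<le> (if \<exists>e\<in>?G. m e = 1 then 0 else p ^ card {e \<in> ?G. m e > 0})" for m
    using p by (intro abs_expectation_prod_centred_indicator_le) auto
  show "finite (set_pmf (bip_pmf n1 n2 p))" by (rule finite_set_bip_pmf)
  show "1 \<le> n2" using n by simp
qed (rule p)+

lemma prob_centred_biadjacency_norm_ge:
  assumes n: "1 \<le> n1" "n1 \<le> n2" and p: "0 < p" "p \<le> 1" and \<rho>: "\<rho> > 0" and k: "k > 0"
  shows "measure_pmf.prob (bip_pmf n1 n2 p) {f. spectral_norm_le (centred_biadjacency n1 n2 p f) \<rho>}
    \<ge> 1 - real (n1 + n2) * ((2 * sqrt (real n2 * p) + 3 * (real (2 * k))\<^sup>2) / \<rho>) ^ (2 * k)"
proof -
  let ?G = "bip_edges n1 n2 (\<lambda>_. True)" and ?n = "n1 + n2"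
  interpret M: random_symmetric_matrix "bip_pmf n1 n2 p" "centred_indicator n1 n2 p" ?G ?n n2 p
    by (rule random_symmetric_matrix_bip_pmf[OF n p])
  have "spectral_norm_le (centred_biadjacency n1 n2 p f) \<rho>"
    if bound: "\<forall>x. \<bar>quad_form (M.X f) x\<bar> \<le> \<rho> * (\<Sum>i<?n. (x i)\<^sup>2)" for f
  proof -
    have "spectral_norm_le (Matrix.mat n1 n2 (\<lambda>(i, j). M.X f $$ (i, n1 + j))) \<rho>"
    proof (rule spectral_norm_le_of_quad_form_block)
      show "M.X f \<in> carrier_mat ?n ?n" by (simp add: M.X_def)
      show "(M.X f)\<^sup>T = M.X f" by (auto simp: M.X_def insert_commute intro!: eq_matI)
      show "M.X f $$ (u, v) = 0" if "u < ?n" "v < ?n" "u < n1 \<longleftrightarrow> v < n1" for u v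
        using that by (simp add: M.X_def bip_edges_same_side)
      show "\<bar>quad_form (M.X f) x\<bar> \<le> \<rho> * (\<Sum>i<?n. (x i)\<^sup>2)" for x
        using bound by blast
    qed
    also have "Matrix.mat n1 n2 (\<lambda>(i, j). M.X f $$ (i, n1 + j)) = centred_biadjacency n1 n2 p f"
      by (auto simp: M.X_def centred_biadjacency_def centred_indicator_def bip_edges_iff
        intro!: eq_matI)
    finally show ?thesis .
  qed
  hence "measure_pmf.prob (bip_pmf n1 n2 p) {f. \<forall>x. \<bar>quad_form (M.X f) x\<bar> \<le> \<rho> * (\<Sum>i<?n. (x i)\<^sup>2)}
      \<le> measure_pmf.prob (bip_pmf n1 n2 p) {f. spectral_norm_le (centred_biadjacency n1 n2 p f) \<rho>}"
    by (intro measure_pmf.finite_measure_mono) auto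
  with M.prob_quad_form_le_ge[OF \<rho> k] show ?thesis by (simp add: M.\<sigma>_def)
qed

lemma prob_bip_sums_ge_Chernoff:
  fixes d :: nat
  assumes p: "0 \<le> p" "p \<le> 1" and \<delta>: "\<delta> \<ge> 0" and I: "finite I"
    and S: "\<And>i. i \<in> I \<Longrightarrow> S i \<subseteq> {..<n1} \<times> {..<n2}" "\<And>i. i \<in> I \<Longrightarrow> card (S i) = d"
  shows "measure_pmf.prob (bip_pmf n1 n2 p)
    {f. \<forall>i\<in>I. (\<Sum>x\<in>S i. of_bool (f x)) \<ge> (1 - \<delta>) * (real d * p)}
    \<ge> 1 - real (card I) * exp (- (\<delta>\<^sup>2 * (real d * p) / 2))"
proof (rule prob_Ball_ge[OF I])
  fix i assume i: "i \<in> I"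
  have "1 - exp (- (\<delta>\<^sup>2 * (real d * p) / 2))
      \<le> measure_pmf.prob (bip_pmf n1 n2 p) {f. (\<Sum>x\<in>S i. of_bool (f x)) > (1 - \<delta>) * (real d * p)}"
    unfolding bip_pmf_def
    using prob_sum_bernoulli_ge_Chernoff[of _ "S i" "\<lambda>_. p"] p \<delta> S[OF i] by simp
  also have "\<dots> \<le> measure_pmf.prob (bip_pmf n1 n2 p)
    {f. (\<Sum>x\<in>S i. of_bool (f x)) \<ge> (1 - \<delta>) * (real d * p)}"
    by (intro measure_pmf.finite_measure_mono) auto
  finally show "1 - exp (- (\<delta>\<^sup>2 * (real d * p) / 2))
      \<le> measure_pmf.prob (bip_pmf n1 n2 p) {f. (\<Sum>x\<in>S i. of_bool (f x)) \<ge> (1 - \<delta>) * (real d * p)}" .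
qed

lemma prob_left_degree_ge_Chernoff:
  assumes "0 \<le> p" "p \<le> 1" "\<delta> \<ge> 0"
  shows "measure_pmf.prob (bip_pmf n1 n2 p)
    {f. \<forall>i\<in>{..<n1}. left_degree n2 f i \<ge> (1 - \<delta>) * (real n2 * p)}
    \<ge> 1 - real n1 * exp (- (\<delta>\<^sup>2 * (real n2 * p) / 2))"
proof -
  have "left_degree n2 f i = (\<Sum>x\<in>{i} \<times> {..<n2}. of_bool (f x))" for f i
    using sum.cartesian_product[of "\<lambda>i j. of_bool (f (i, j)) :: real" "{..<n2}" "{i}"]
    by (simp add: left_degree_def case_prod_unfold del: sum_of_bool_eq)
  thus ?thesis
    using prob_bip_sums_ge_Chernoff[OF assms finite_lessThan, of n1 "\<lambda>i. {i} \<times> {..<n2}" n1 n2 n2]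
    by (auto simp del: sum_of_bool_eq)
qed

lemma prob_right_degree_ge_Chernoff:
  assumes "0 \<le> p" "p \<le> 1" "\<delta> \<ge> 0"
  shows "measure_pmf.prob (bip_pmf n1 n2 p)
    {f. \<forall>j\<in>{..<n2}. right_degree n1 f j \<ge> (1 - \<delta>) * (real n1 * p)}
    \<ge> 1 - real n2 * exp (- (\<delta>\<^sup>2 * (real n1 * p) / 2))"
proof -
  have "right_degree n1 f j = (\<Sum>x\<in>{..<n1} \<times> {j}. of_bool (f x))" for f j
    using sum.cartesian_product[of "\<lambda>i j. of_bool (f (i, j)) :: real" "{j}" "{..<n1}"]
    by (simp add: right_degree_def case_prod_unfold del: sum_of_bool_eq)
  thus ?thesis
    using prob_bip_sums_ge_Chernoff[OF assms finite_lessThan, of n2 "\<lambda>j. {..<n1} \<times> {j}" n1 n2 n1]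
    by (auto simp del: sum_of_bool_eq)
qed

section \<open>The two-step matrix\<close>

lemma column_projection_cong:
  assumes "\<And>i. i < n1 \<Longrightarrow> f (i, j) = f' (i, j)"
  shows "column_projection n1 f j = column_projection n1 f' j"
proof -
  have "right_degree n1 f j = right_degree n1 f' j"
    unfolding right_degree_def using assms by (intro sum.cong) auto
  thus ?thesis unfolding column_projection_def using assms by (intro eq_matI) auto
qed

lemma column_projection_nonneg:
  assumes "i < n1" "k < n1"
  shows "column_projection n1 f j $$ (i, k) \<ge> 0"
  using assms by (simp add: column_projection_def right_degree_nonneg)

lemma trace_column_projection_le: "(\<Sum>i<n1. column_projection n1 f j $$ (i, i)) \<le> 1"
proof -
  have "(\<Sum>i<n1. column_projection n1 f j $$ (i, i))
    = (\<Sum>i<n1. of_bool (f (i, j)) / right_degree n1 f j)"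
    by (intro sum.cong) (auto simp: column_projection_def)
  also have "\<dots> = right_degree n1 f j / right_degree n1 f j"
    unfolding sum_divide_distrib[symmetric] by (simp only: right_degree_def)
  finally show ?thesis by simp
qed

lemma sum_square_column_projection_le: "(\<Sum>i<n1. \<Sum>k<n1. (column_projection n1 f j $$ (i, k))\<^sup>2) \<le> 1"
proof -
  have "(\<Sum>i<n1. \<Sum>k<n1. (column_projection n1 f j $$ (i, k))\<^sup>2)
      = (\<Sum>i<n1. \<Sum>k<n1. of_bool (f (i, j)) * of_bool (f (k, j))) / (right_degree n1 f j)\<^sup>2"
    unfolding sum_divide_distrib
    by (intro sum.cong refl) (auto simp: column_projection_def power_divide)
  also have "\<dots> = (right_degree n1 f j)\<^sup>2 / (right_degree n1 f j)\<^sup>2"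
    unfolding right_degree_def power2_eq_square sum_product ..
  finally show ?thesis by simp
qed

lemma quad_form_square_le:
  assumes "A \<in> carrier_mat n n"
  shows "(quad_form A z)\<^sup>2 \<le> (\<Sum>i<n. \<Sum>k<n. (A $$ (i, k))\<^sup>2) * (\<Sum>i<n. (z i)\<^sup>2)\<^sup>2"
proof -
  let ?I = "{..<n} \<times> {..<n}"
  have "(quad_form A z)\<^sup>2 = (\<Sum>x\<in>?I. A $$ x * (z (fst x) * z (snd x)))\<^sup>2"
    using assms by (simp add: bilinear_form_def sum.cartesian_product case_prod_unfold mult.assoc)
  also have "\<dots> \<le> (\<Sum>x\<in>?I. (A $$ x)\<^sup>2) * (\<Sum>x\<in>?I. (z (fst x) * z (snd x))\<^sup>2)"
    by (rule Cauchy_Schwarz_ineq_sum)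
  also have "(\<Sum>x\<in>?I. (z (fst x) * z (snd x))\<^sup>2) = (\<Sum>i<n. (z i)\<^sup>2)\<^sup>2"
    by (simp add: power2_eq_square[of "\<Sum>i<n. (z i)\<^sup>2"] sum_product
        sum.cartesian_product case_prod_unfold power_mult_distrib)
  finally show ?thesis by (simp add: sum.cartesian_product case_prod_unfold)
qed

text \<open>A matrix that is invariant under all permutations is a combination of the identity and the
  all-ones matrix, and the latter vanishes on \<open>z\<close>.\<close>
lemma quad_form_exchangeable_le:
  assumes A: "A \<in> carrier_mat n n" and nonneg: "\<And>i k. i < n \<Longrightarrow> k < n \<Longrightarrow> A $$ (i, k) \<ge> 0"
    and invariant: "\<And>\<pi> i k. \<pi> permutes {..<n} \<Longrightarrow> i < n \<Longrightarrow> k < n \<Longrightarrow> A $$ (\<pi> i, \<pi> k) = A $$ (i, k)"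
    and z: "(\<Sum>i<n. z i) = 0"
  shows "real n * quad_form A z \<le> (\<Sum>i<n. A $$ (i, i)) * (\<Sum>i<n. (z i)\<^sup>2)"
proof -
  define d where "d = A $$ (0, 0)"
  define c where "c = (if n \<ge> 2 then A $$ (0, 1) else 0)"
  have diag: "A $$ (i, i) = d" if "i < n" for i
    using invariant[OF permutes_swap_id[of 0 "{..<n}" i], of 0 0] that by (simp add: d_def)
  have offdiag: "A $$ (i, k) = c" if "i < n" "k < n" "i \<noteq> k" for i k
  proof -
    define h where "h = Transposition.transpose i 0 k"
    have h: "h < n" "h \<noteq> 0" and n: "n \<ge> 2"
      using that by (auto simp: h_def Transposition.transpose_def)
    have "A $$ (i, k) = A $$ (0, h)"
      using invariant[OF permutes_swap_id[of i "{..<n}" 0], of i k] that by (simp add: h_def)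
    also have "\<dots> = A $$ (0, 1)"
      using invariant[OF permutes_swap_id[of h "{..<n}" 1], of 0 h] h n
        by (simp add: Transposition.transpose_def)
    finally show ?thesis using n by (simp add: c_def)
  qed
  have row: "(\<Sum>k<n. A $$ (i, k) * z i * z k) = (d - c) * (z i)\<^sup>2" if "i < n" for i
  proof -
    have "(\<Sum>k<n. A $$ (i, k) * z i * z k)
      = (\<Sum>k<n. c * z i * z k + (if k = i then (d - c) * (z i)\<^sup>2 else 0))"
      using diag offdiag that by (intro sum.cong) (auto simp: power2_eq_square algebra_simps)
    also have "\<dots> = c * z i * (\<Sum>k<n. z k) + (d - c) * (z i)\<^sup>2"
      using that by (simp add: sum.distrib sum_distrib_left)
    finally show ?thesis using z by simp
  qed
  have "c \<ge> 0" using nonneg[of 0 1] by (simp add: c_def)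
  have "quad_form A z = (d - c) * (\<Sum>i<n. (z i)\<^sup>2)"
    using A row by (simp add: bilinear_form_def sum_distrib_left)
  also have "\<dots> \<le> d * (\<Sum>i<n. (z i)\<^sup>2)"
    using \<open>c \<ge> 0\<close> by (intro mult_right_mono) (auto simp: sum_nonneg)
  finally have "real n * quad_form A z \<le> real n * (d * (\<Sum>i<n. (z i)\<^sup>2))"
    by (intro mult_left_mono) auto
  thus ?thesis using diag by simp
qed

definition two_step_mean :: "nat \<Rightarrow> nat \<Rightarrow> real \<Rightarrow> real mat" where
  "two_step_mean n1 n2 p =
     Matrix.mat n1 n1 (\<lambda>ik.
       measure_pmf.expectation (bip_pmf n1 n2 p) (\<lambda>f. two_step_matrix n1 n2 f $$ ik))"

lemma integrable_bip_pmf [simp]: "integrable (measure_pmf (bip_pmf n1 n2 p)) (g :: _ \<Rightarrow> real)"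
  by (rule integrable_measure_pmf_finite[OF finite_set_bip_pmf])

lemma expectation_column_projection_mult:
  assumes "i < n1" "k < n1" "j < n2" "l < n2" "j \<noteq> l"
  defines "Y \<equiv> \<lambda>j f. column_projection n1 f j $$ (i, k)"
  shows "measure_pmf.expectation (bip_pmf n1 n2 p) (\<lambda>f. Y j f * Y l f)
    = measure_pmf.expectation (bip_pmf n1 n2 p) (Y j)
      * measure_pmf.expectation (bip_pmf n1 n2 p) (Y l)"
proof (rule prob_space.indep_var_lebesgue_integral[OF measure_pmf.prob_space_axioms])
  show "prob_space.indep_var (bip_pmf n1 n2 p) borel (Y j) borel (Y l)"
    unfolding bip_pmf_def
  proof (rule indep_var_Pi_pmf)
    show "Y j f = Y j f'" if "\<And>x. x \<in> {..<n1} \<times> {j} \<Longrightarrow> f x = f' x" for f f'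
      using column_projection_cong[of n1 f j f'] that by (simp add: Y_def)
    show "Y l f = Y l f'" if "\<And>x. x \<in> {..<n1} \<times> {l} \<Longrightarrow> f x = f' x" for f f'
      using column_projection_cong[of n1 f l f'] that by (simp add: Y_def)
  qed (use assms in auto)
qed simp_all

lemma expectation_two_step_deviation_le:
  "measure_pmf.expectation (bip_pmf n1 n2 p)
     (\<lambda>f. \<Sum>i<n1. \<Sum>k<n1. ((two_step_matrix n1 n2 f - two_step_mean n1 n2 p) $$ (i, k))\<^sup>2) \<le> real n2"
proof -
  let ?E = "measure_pmf.expectation (bip_pmf n1 n2 p)"
  let ?T = "two_step_matrix n1 n2" and ?M = "two_step_mean n1 n2 p" and ?Y = "column_projection n1"
  have entry: "?E (\<lambda>f. ((?T f - ?M) $$ (i, k))\<^sup>2) \<le> ?E (\<lambda>f. \<Sum>j<n2. (?Y f j $$ (i, k))\<^sup>2)"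
    if "i < n1" "k < n1" for i k
  proof -
    have "?E (\<lambda>f. ((?T f - ?M) $$ (i, k))\<^sup>2)
      = measure_pmf.variance (bip_pmf n1 n2 p) (\<lambda>f. \<Sum>j<n2. ?Y f j $$ (i, k))"
      using that by (simp add: two_step_mean_def two_step_matrix_def)
    also have "\<dots> = (\<Sum>j<n2. measure_pmf.variance (bip_pmf n1 n2 p) (\<lambda>f. ?Y f j $$ (i, k)))"
      using that
      by (intro variance_sum_uncorrelated finite_set_bip_pmf expectation_column_projection_mult)
        auto
    also have "\<dots> \<le> (\<Sum>j<n2. ?E (\<lambda>f. (?Y f j $$ (i, k))\<^sup>2))"
      by (intro sum_mono) (simp add: measure_pmf.variance_eq)
    finally show ?thesis by simp
  qed
  have "?E (\<lambda>f. \<Sum>i<n1. \<Sum>k<n1. ((?T f - ?M) $$ (i, k))\<^sup>2)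
    = (\<Sum>i<n1. \<Sum>k<n1. ?E (\<lambda>f. ((?T f - ?M) $$ (i, k))\<^sup>2))"
    by simp
  also have "\<dots> \<le> (\<Sum>i<n1. \<Sum>k<n1. ?E (\<lambda>f. \<Sum>j<n2. (?Y f j $$ (i, k))\<^sup>2))"
    by (intro sum_mono entry) auto
  also have "\<dots> = ?E (\<lambda>f. \<Sum>i<n1. \<Sum>k<n1. \<Sum>j<n2. (?Y f j $$ (i, k))\<^sup>2)"
    by simp
  also have "\<dots> \<le> ?E (\<lambda>f. real n2)"
  proof (intro integral_mono)
    fix f
    have "(\<Sum>i<n1. \<Sum>k<n1. \<Sum>j<n2. (?Y f j $$ (i, k))\<^sup>2) = (\<Sum>i<n1. \<Sum>j<n2. \<Sum>k<n1. (?Y f j $$ (i, k))\<^sup>2)"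
      by (intro sum.cong refl sum.swap)
    also have "\<dots> = (\<Sum>j<n2. \<Sum>i<n1. \<Sum>k<n1. (?Y f j $$ (i, k))\<^sup>2)" by (rule sum.swap)
    also have "\<dots> \<le> (\<Sum>j<n2. 1)" by (intro sum_mono sum_square_column_projection_le)
    finally show "(\<Sum>i<n1. \<Sum>k<n1. \<Sum>j<n2. (?Y f j $$ (i, k))\<^sup>2) \<le> real n2" by simp
  qed simp_all
  finally show ?thesis by simp
qed

lemma map_bip_pmf_permute:
  assumes \<pi>: "\<pi> permutes {..<n1}"
  shows "map_pmf (\<lambda>f (i, j). f (\<pi> i, j)) (bip_pmf n1 n2 p) = bip_pmf n1 n2 p"
proof -
  have "bij_betw (map_prod \<pi> id) ({..<n1} \<times> {..<n2}) ({..<n1} \<times> {..<n2})"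
    using \<pi> by (intro bij_betw_map_prod) (auto simp: permutes_imp_bij)
  moreover have "map_prod \<pi> id x \<notin> {..<n1} \<times> {..<n2}" if "x \<notin> {..<n1} \<times> {..<n2}" for x
    using that permutes_in_image[OF \<pi>] by (cases x) auto
  ultimately have "bip_pmf n1 n2 p = map_pmf (\<lambda>g. g \<circ> map_prod \<pi> id) (bip_pmf n1 n2 p)"
    unfolding bip_pmf_def by (intro Pi_pmf_bij_betw) auto
  thus ?thesis by (simp add: o_def map_prod_def case_prod_unfold)
qed

lemma two_step_mean_permute:
  assumes \<pi>: "\<pi> permutes {..<n1}" and ik: "i < n1" "k < n1"
  shows "two_step_mean n1 n2 p $$ (\<pi> i, \<pi> k) = two_step_mean n1 n2 p $$ (i, k)"
proof -
  let ?E = "measure_pmf.expectation (bip_pmf n1 n2 p)"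
  define permute :: "(nat \<times> nat \<Rightarrow> bool) \<Rightarrow> nat \<times> nat \<Rightarrow> bool"
    where "permute f = (\<lambda>(i, j). f (\<pi> i, j))" for f
  have \<pi>ik: "\<pi> i < n1" "\<pi> k < n1" using permutes_in_image[OF \<pi>] ik by auto
  have "right_degree n1 (permute f) j = right_degree n1 f j" for f j
    unfolding right_degree_def permute_def
    using sum.permute[OF \<pi>, of "\<lambda>i. of_bool (f (i, j)) :: real"] by (simp add: o_def)
  hence step: "two_step_matrix n1 n2 f $$ (\<pi> i, \<pi> k)
    = two_step_matrix n1 n2 (permute f) $$ (i, k)" for f
    using ik \<pi>ik by (simp add: two_step_matrix_def column_projection_def permute_def)
  have "two_step_mean n1 n2 p $$ (\<pi> i, \<pi> k) = ?E (\<lambda>f. two_step_matrix n1 n2 (permute f) $$ (i, k))"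
    using \<pi>ik by (simp add: two_step_mean_def step)
  also have "\<dots> = measure_pmf.expectation (map_pmf permute (bip_pmf n1 n2 p))
    (\<lambda>f. two_step_matrix n1 n2 f $$ (i, k))"
    by simp
  also have "map_pmf permute (bip_pmf n1 n2 p) = bip_pmf n1 n2 p"
    unfolding permute_def[abs_def] by (rule map_bip_pmf_permute[OF \<pi>])
  finally show ?thesis using ik by (simp add: two_step_mean_def)
qed

lemma trace_two_step_mean_le: "(\<Sum>i<n1. two_step_mean n1 n2 p $$ (i, i)) \<le> real n2"
proof -
  let ?E = "measure_pmf.expectation (bip_pmf n1 n2 p)"
  have "(\<Sum>i<n1. two_step_mean n1 n2 p $$ (i, i))
    = ?E (\<lambda>f. \<Sum>i<n1. two_step_matrix n1 n2 f $$ (i, i))"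
    by (simp add: two_step_mean_def)
  also have "\<dots> \<le> ?E (\<lambda>f. real n2)"
  proof (intro integral_mono)
    fix f
    have "(\<Sum>i<n1. two_step_matrix n1 n2 f $$ (i, i))
      = (\<Sum>j<n2. \<Sum>i<n1. column_projection n1 f j $$ (i, i))"
      by (simp add: two_step_matrix_def sum.swap[of _ "{..<n1}"])
    also have "\<dots> \<le> (\<Sum>j<n2. 1)" by (intro sum_mono trace_column_projection_le)
    finally show "(\<Sum>i<n1. two_step_matrix n1 n2 f $$ (i, i)) \<le> real n2" by simp
  qed simp_all
  finally show ?thesis by simp
qed

lemma quad_form_two_step_mean_le:
  assumes n: "n1 > 0" and z: "(\<Sum>i<n1. z i) = 0"
  shows "quad_form (two_step_mean n1 n2 p) z \<le> real n2 / real n1 * (\<Sum>i<n1. (z i)\<^sup>2)"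
proof -
  have nonneg: "two_step_mean n1 n2 p $$ (i, k) \<ge> 0" if "i < n1" "k < n1" for i k
    using that by (auto simp: two_step_mean_def two_step_matrix_def column_projection_nonneg
        intro!: Bochner_Integration.integral_nonneg sum_nonneg)
  have "real n1 * quad_form (two_step_mean n1 n2 p) z
      \<le> (\<Sum>i<n1. two_step_mean n1 n2 p $$ (i, i)) * (\<Sum>i<n1. (z i)\<^sup>2)"
  proof (rule quad_form_exchangeable_le)
    show "two_step_mean n1 n2 p \<in> carrier_mat n1 n1" by (simp add: two_step_mean_def)
  qed (use nonneg two_step_mean_permute z in auto)
  also have "\<dots> \<le> real n2 * (\<Sum>i<n1. (z i)\<^sup>2)"
    by (intro mult_right_mono trace_two_step_mean_le) (simp add: sum_nonneg)
  finally show ?thesis using n by (simp add: field_simps)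
qed

lemma prob_quad_form_two_step_le_ge:
  assumes n: "n1 > 0" "n2 > 0"
  shows "measure_pmf.prob (bip_pmf n1 n2 p) {f. \<forall>z. (\<Sum>i<n1. z i) = 0 \<longrightarrow>
      quad_form (two_step_matrix n1 n2 f) z \<le> 2 * (real n2 / real n1) * (\<Sum>i<n1. (z i)\<^sup>2)}
    \<ge> 1 - (real n1)\<^sup>2 / real n2"
proof -
  let ?P = "bip_pmf n1 n2 p" and ?T = "two_step_matrix n1 n2" and ?M = "two_step_mean n1 n2 p"
  define r where "r = real n2 / real n1"
  have r: "r > 0" using n by (simp add: r_def)
  define dev where "dev f = (\<Sum>i<n1. \<Sum>k<n1. ((?T f - ?M) $$ (i, k))\<^sup>2)" for f
  have carrier: "?T f \<in> carrier_mat n1 n1" "?M \<in> carrier_mat n1 n1" for f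
    by (simp_all add: two_step_matrix_def two_step_mean_def)
  have good: "quad_form (?T f) z \<le> 2 * r * (\<Sum>i<n1. (z i)\<^sup>2)"
    if z: "(\<Sum>i<n1. z i) = 0" and small: "dev f < r\<^sup>2" for f z
  proof -
    let ?s = "\<Sum>i<n1. (z i)\<^sup>2"
    have "(quad_form (?T f - ?M) z)\<^sup>2 \<le> dev f * ?s\<^sup>2"
      unfolding dev_def using carrier by (intro quad_form_square_le) auto
    also have "\<dots> \<le> (r * ?s)\<^sup>2"
      unfolding power_mult_distrib using small by (intro mult_right_mono) auto
    finally have "quad_form (?T f - ?M) z \<le> r * ?s"
      by (rule power2_le_imp_le) (use r in \<open>simp add: sum_nonneg\<close>)
    moreover have "quad_form (?T f) z = quad_form (?T f - ?M) z + quad_form ?M z"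
      using carrier_matD[OF carrier(1)] carrier_matD[OF carrier(2)]
      by (simp add: bilinear_form_def left_diff_distrib sum_subtractf)
    ultimately show ?thesis
      using quad_form_two_step_mean_le[OF n(1) z, of n2 p, folded r_def] by linarith
  qed
  have "1 - (real n1)\<^sup>2 / real n2 = 1 - real n2 / r\<^sup>2"
    using n by (simp add: r_def power2_eq_square)
  also have "\<dots> \<le> 1 - measure_pmf.expectation ?P dev / r\<^sup>2"
    using expectation_two_step_deviation_le[of n1 n2 p] unfolding dev_def
    by (intro diff_left_mono divide_right_mono) auto
  also have "\<dots> \<le> measure_pmf.prob ?P {f. dev f < r\<^sup>2}"
    using r by (intro prob_less_ge_Markov finite_set_bip_pmf) (auto simp: dev_def sum_nonneg)
  also have "\<dots> \<le> measure_pmf.prob ?P {f. \<forall>z. (\<Sum>i<n1. z i) = 0 \<longrightarrow>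
    quad_form (?T f) z \<le> 2 * r * (\<Sum>i<n1. (z i)\<^sup>2)}"
    using good by (intro measure_pmf.finite_measure_mono) auto
  finally show ?thesis by (simp add: r_def)
qed

section \<open>Asymptotics\<close>

locale dense_random_bipartite =
  fixes n1 n2 :: nat and p :: real
  assumes n: "2 \<le> n1" "n1 \<le> n2" and p: "0 < p" "p \<le> 1"
    and dense_left: "128 * ln (real n1) \<le> real n1 * p"
    and dense_right: "12 * (20 * ln (real n2))\<^sup>2 \<le> sqrt (real n2 * p)"
begin

lemma walk_length_exists:
  obtains k :: nat where "k > 0" "8 * ln (real (n1 + n2)) \<le> real (2 * k)"
    "12 * (real (2 * k))\<^sup>2 \<le> sqrt (real n2 * p)"
proof
  let ?N = "real (n1 + n2)"
  define k where "k = nat \<lceil>4 * ln ?N\<rceil>"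
  have lnN: "ln ?N > 0" using n by simp
  hence k: "4 * ln ?N \<le> real k" "real k \<le> 4 * ln ?N + 1" unfolding k_def by linarith+
  show "k > 0" using k(1) lnN by (cases k) auto
  show "8 * ln ?N \<le> real (2 * k)" using k(1) by simp
  have "?N \<le> 2 * real n2" using n by simp
  also have "\<dots> \<le> (real n2)\<^sup>2" unfolding power2_eq_square using n by (intro mult_right_mono) auto
  finally have "ln ?N \<le> ln ((real n2)\<^sup>2)" using n by (intro ln_mono) auto
  hence "ln ?N \<le> 2 * ln (real n2)" using n by (simp add: ln_realpow)
  moreover have "ln 2 \<le> ln (real n2)" using n by (intro ln_mono) auto
  hence "2 \<le> 3 * ln (real n2)" using ln2_ge_two_thirds by linarith
  ultimately have "real (2 * k) \<le> 20 * ln (real n2)" using k(2) by simp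
  hence "(real (2 * k))\<^sup>2 \<le> (20 * ln (real n2))\<^sup>2" by (intro power_mono) auto
  thus "12 * (real (2 * k))\<^sup>2 \<le> sqrt (real n2 * p)" using dense_right by linarith
qed

lemma prob_spectral_norm_ge:
  "measure_pmf.prob (bip_pmf n1 n2 p)
    {f. spectral_norm_le (centred_biadjacency n1 n2 p f) (3 * sqrt (real n2 * p))}
    \<ge> 1 - 1 / real n1"
proof -
  let ?N = "real (n1 + n2)"
  define \<sigma> where "\<sigma> = sqrt (real n2 * p)"
  have \<sigma>: "\<sigma> > 0" using n p by (simp add: \<sigma>_def)
  obtain k :: nat where k: "k > 0" "8 * ln ?N \<le> real (2 * k)" "12 * (real (2 * k))\<^sup>2 \<le> \<sigma>"
    unfolding \<sigma>_def by (rule walk_length_exists)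
  define x where "x = (2 * \<sigma> + 3 * (real (2 * k))\<^sup>2) / (3 * \<sigma>)"
  have "x \<le> 1 + - 1 / 4" using k(3) \<sigma> by (simp add: x_def field_simps)
  also have "\<dots> \<le> exp (- 1 / 4)" by (rule exp_ge_add_one_self)
  finally have "x ^ (2 * k) \<le> exp (- 1 / 4) ^ (2 * k)"
    using \<sigma> by (intro power_mono) (auto simp: x_def)
  also have "\<dots> = exp (- real (2 * k) / 4)" by (simp flip: exp_of_nat_mult)
  also have "\<dots> \<le> exp (- (2 * ln ?N))" using k(2) by simp
  also have "\<dots> = 1 / ?N\<^sup>2" using n by (simp add: exp_minus exp_double inverse_eq_divide)
  finally have "?N * x ^ (2 * k) \<le> ?N * (1 / ?N\<^sup>2)" by (intro mult_left_mono) auto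
  also have "\<dots> = 1 / ?N" by (simp add: power2_eq_square)
  also have "\<dots> \<le> 1 / real n1" using n by (intro divide_left_mono) auto
  finally have "1 - 1 / real n1 \<le> 1 - ?N * x ^ (2 * k)" by simp
  also have "\<dots> \<le> measure_pmf.prob (bip_pmf n1 n2 p)
    {f. spectral_norm_le (centred_biadjacency n1 n2 p f) (3 * \<sigma>)}"
    unfolding x_def
    using n p \<sigma> k(1) prob_centred_biadjacency_norm_ge[of n1 n2 p "3 * \<sigma>" k] by (simp add: \<sigma>_def)
  finally show ?thesis by (simp add: \<sigma>_def)
qed

lemma exp_mean_degree_le:
  assumes "a \<ge> real n1 * p"
  shows "exp (- ((1 / 4)\<^sup>2 * a / 2)) \<le> 1 / real n1 ^ 4"
proof -
  have "- ((1 / 4)\<^sup>2 * a / 2) \<le> - (4 * ln (real n1))"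
    using assms dense_left by (simp add: power2_eq_square)
  hence "exp (- ((1 / 4)\<^sup>2 * a / 2)) \<le> exp (- ln (real n1 ^ 4))"
    using n by (simp add: ln_realpow)
  thus ?thesis using n by (simp add: exp_minus inverse_eq_divide)
qed

lemma prob_left_degree_ge:
  "measure_pmf.prob (bip_pmf n1 n2 p) {f. \<forall>i\<in>{..<n1}. left_degree n2 f i \<ge> 3 / 4 * (real n2 * p)}
    \<ge> 1 - 1 / real n1"
proof -
  have "real n1 * exp (- ((1 / 4)\<^sup>2 * (real n2 * p) / 2)) \<le> real n1 * (1 / real n1 ^ 4)"
    using n p by (intro mult_left_mono exp_mean_degree_le) auto
  also have "\<dots> = 1 / real n1 ^ 3" using n by (simp add: field_simps eval_nat_numeral)
  also have "\<dots> \<le> 1 / real n1" using n self_le_power[of "real n1" 3] by (intro divide_left_mono) auto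
  finally show ?thesis
    using prob_left_degree_ge_Chernoff[of p "1 / 4" n1 n2] p by simp
qed

lemma prob_right_degree_ge:
  assumes "n2 \<le> n1 ^ 3"
  shows "measure_pmf.prob (bip_pmf n1 n2 p)
    {f. \<forall>j\<in>{..<n2}. right_degree n1 f j \<ge> 3 / 4 * (real n1 * p)} \<ge> 1 - 1 / real n1"
proof -
  have "real n2 \<le> real n1 ^ 3" using assms by (simp flip: of_nat_power)
  hence "real n2 * exp (- ((1 / 4)\<^sup>2 * (real n1 * p) / 2)) \<le> real n1 ^ 3 * (1 / real n1 ^ 4)"
    using p by (intro mult_mono exp_mean_degree_le) auto
  also have "\<dots> = 1 / real n1" using n by (simp add: field_simps eval_nat_numeral)
  finally show ?thesis
    using prob_right_degree_ge_Chernoff[of p "1 / 4" n2 n1] p by simp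
qed

lemma prob_random_bipartite_ge:
  assumes "\<And>f. Q f \<Longrightarrow> R (bip_edges n1 n2 f)" "measure_pmf.prob (bip_pmf n1 n2 p) {f. Q f} \<ge> b"
  shows "measure_pmf.prob (random_bipartite n1 n2 p) {E. R E} \<ge> b"
proof -
  have "b \<le> measure_pmf.prob (bip_pmf n1 n2 p) {f. R (bip_edges n1 n2 f)}"
    using assms(2)
    by (rule order_trans) (use assms(1) in \<open>auto intro!: measure_pmf.finite_measure_mono\<close>)
  thus ?thesis by (simp add: random_bipartite_eq_map_bip_pmf vimage_def)
qed

lemma prob_mu_adjacency_ge:
  "measure_pmf.prob (random_bipartite n1 n2 p) {E. mu 2 (adjacency_matrix (n1 + n2) E)
    \<le> 2 * (sqrt (real (n1 + n2) * p) + sqrt (real n1 * p) + sqrt (real n2 * p))} \<ge> 1 - 1 / real n1"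
proof (rule prob_random_bipartite_ge[OF _ prob_spectral_norm_ge])
  fix f assume "spectral_norm_le (centred_biadjacency n1 n2 p f) (3 * sqrt (real n2 * p))"
  hence "mu 2 (adjacency_matrix (n1 + n2) (bip_edges n1 n2 f)) \<le> 3 * sqrt (real n2 * p)"
    using mu_adjacency_near_0[of n1 n2 p f _ 2] n p by fastforce
  moreover have "sqrt (real n2 * p) \<le> sqrt (real (n1 + n2) * p)" using p by simp
  moreover have "sqrt (real n1 * p) \<ge> 0" "sqrt (real n2 * p) \<ge> 0" using p by simp_all
  ultimately show "mu 2 (adjacency_matrix (n1 + n2) (bip_edges n1 n2 f))
      \<le> 2 * (sqrt (real (n1 + n2) * p) + sqrt (real n1 * p) + sqrt (real n2 * p))"
    by argo
qed

lemma prob_laplacian_deviation_ge_of_degrees: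
  assumes "n2 \<le> n1 ^ 3"
  shows "measure_pmf.prob (random_bipartite n1 n2 p)
    {E. laplacian_deviation (n1 + n2) E \<le> 4 / sqrt (real n1 * p)} \<ge> 1 - 3 / real n1"
proof -
  let ?good = "\<lambda>f. (\<forall>i\<in>{..<n1}. left_degree n2 f i \<ge> 3 / 4 * (real n2 * p))
    \<and> (\<forall>j\<in>{..<n2}. right_degree n1 f j \<ge> 3 / 4 * (real n1 * p))
    \<and> spectral_norm_le (centred_biadjacency n1 n2 p f) (3 * sqrt (real n2 * p))"
  have prob: "measure_pmf.prob (bip_pmf n1 n2 p) {f. ?good f} \<ge> 1 - 3 / real n1"
    using prob_conj_ge[OF prob_left_degree_ge
      prob_conj_ge[OF prob_right_degree_ge[OF assms] prob_spectral_norm_ge]]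
    by simp
  have "laplacian_deviation (n1 + n2) (bip_edges n1 n2 f)
    \<le> 4 / sqrt (real n1 * p)" if "?good f" for f
  proof -
    have "laplacian_deviation (n1 + n2) (bip_edges n1 n2 f)
        \<le> 3 * sqrt (real n2 * p) / (sqrt (3 / 4 * (real n2 * p)) * sqrt (3 / 4 * (real n1 * p)))"
      using that n p by (intro laplacian_deviation_le_of_degrees[where p = p]) auto
    also have "\<dots> = 3 * sqrt (real n2 * p)
      / (sqrt (3 / 4) * sqrt (3 / 4) * sqrt (real n2 * p) * sqrt (real n1 * p))"
      unfolding real_sqrt_mult[of "3 / 4"] by (simp only: mult_ac)
    also have "\<dots> = 4 / sqrt (real n1 * p)" using n p by simp
    finally show ?thesis .
  qed
  thus ?thesis by (rule prob_random_bipartite_ge[where Q = ?good, OF _ prob])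
qed

lemma prob_laplacian_deviation_ge_of_two_step:
  assumes "n1 ^ 3 \<le> n2"
  shows "measure_pmf.prob (random_bipartite n1 n2 p)
    {E. laplacian_deviation (n1 + n2) E \<le> 4 / sqrt (real n1 * p)} \<ge> 1 - 3 / real n1"
proof -
  let ?contracting = "\<lambda>f. \<forall>z. (\<Sum>i<n1. z i) = 0 \<longrightarrow>
    quad_form (two_step_matrix n1 n2 f) z \<le> 2 * (real n2 / real n1) * (\<Sum>i<n1. (z i)\<^sup>2)"
  let ?good = "\<lambda>f. (\<forall>i\<in>{..<n1}. left_degree n2 f i \<ge> 3 / 4 * (real n2 * p)) \<and> ?contracting f"
  have "(real n1)\<^sup>2 / real n2 \<le> (real n1)\<^sup>2 / real n1 ^ 3"
    using assms n by (intro divide_left_mono mult_pos_pos) (auto simp flip: of_nat_power)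
  also have "\<dots> = 1 / real n1" using n by (simp add: field_simps eval_nat_numeral)
  finally have "1 - 1 / real n1 \<le> measure_pmf.prob (bip_pmf n1 n2 p) {f. ?contracting f}"
    using prob_quad_form_two_step_le_ge[of n1 n2 p] n by linarith
  from prob_conj_ge[OF prob_left_degree_ge this]
  have prob: "measure_pmf.prob (bip_pmf n1 n2 p) {f. ?good f} \<ge> 1 - 3 / real n1"
    by (rule order_trans[rotated]) (use n in \<open>simp add: field_simps\<close>)
  have "laplacian_deviation (n1 + n2) (bip_edges n1 n2 f)
    \<le> 4 / sqrt (real n1 * p)" if "?good f" for f
  proof -
    have "laplacian_deviation (n1 + n2) (bip_edges n1 n2 f)
        \<le> sqrt (2 * (real n2 / real n1) / (3 / 4 * (real n2 * p)))"
      using that n p by (intro laplacian_deviation_le_of_two_step) auto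
    also have "\<dots> \<le> sqrt (16 / (real n1 * p))"
      using n p by (intro real_sqrt_le_mono) (simp add: field_simps)
    also have "\<dots> = 4 / sqrt (real n1 * p)" by (simp add: real_sqrt_divide)
    finally show ?thesis .
  qed
  thus ?thesis by (rule prob_random_bipartite_ge[where Q = ?good, OF _ prob])
qed

lemma prob_laplacian_deviation_ge:
  "measure_pmf.prob (random_bipartite n1 n2 p) {E. laplacian_deviation (n1 + n2) E
    \<le> 2 * (sqrt (1 / (real n1 * p) + 1 / (real n2 * p))
      + 1 / sqrt (real n1 * p) + 1 / sqrt (real n2 * p))}
    \<ge> 1 - 3 / real n1"
proof -
  have "1 / sqrt (real n1 * p) \<le> sqrt (1 / (real n1 * p) + 1 / (real n2 * p))"
    using p by (simp flip: real_sqrt_divide add: real_sqrt_divide[of 1, simplified, symmetric])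
  moreover have "1 / sqrt (real n2 * p) \<ge> 0" using p by simp
  ultimately have bound: "4 / sqrt (real n1 * p)
      \<le> 2 * (sqrt (1 / (real n1 * p) + 1 / (real n2 * p))
        + 1 / sqrt (real n1 * p) + 1 / sqrt (real n2 * p))"
    by argo
  have "1 - 3 / real n1 \<le> measure_pmf.prob (random_bipartite n1 n2 p)
      {E. laplacian_deviation (n1 + n2) E \<le> 4 / sqrt (real n1 * p)}"
    using prob_laplacian_deviation_ge_of_degrees prob_laplacian_deviation_ge_of_two_step linear
    by blast
  also have "\<dots> \<le> measure_pmf.prob (random_bipartite n1 n2 p) {E. laplacian_deviation (n1 + n2) E
      \<le> 2 * (sqrt (1 / (real n1 * p) + 1 / (real n2 * p))
        + 1 / sqrt (real n1 * p) + 1 / sqrt (real n2 * p))}"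
    using bound by (intro measure_pmf.finite_measure_mono) auto
  finally show ?thesis .
qed

end

lemma eventually_le_sqrt_of_little_o:
  assumes "little_o (\<lambda>n. sqrt (a n) * g n) a"
  shows "\<forall>\<^sub>F n in sequentially. a n > 0 \<and> g n \<le> sqrt (a n)"
proof -
  have pos: "\<forall>\<^sub>F n in sequentially. a n > 0"
    and lim: "(\<lambda>n. sqrt (a n) * g n / a n) \<longlonglongrightarrow> 0"
    using assms by (auto simp: little_o_def)
  have "\<forall>\<^sub>F n in sequentially. sqrt (a n) * g n / a n < 1"
    using order_tendstoD(2)[OF lim, of 1] by simp
  with pos show ?thesis
  proof eventually_elim
    case (elim n)
    have "sqrt (a n) * g n < a n" using elim by (simp add: divide_less_eq)
    also have "a n = sqrt (a n) * sqrt (a n)" using elim by simp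
    finally have "g n < sqrt (a n)" using elim by (subst (asm) mult_less_cancel_left_pos) auto
    thus ?case using elim by simp
  qed
qed

lemma eventually_dense_random_bipartite:
  assumes n2: "\<And>n. n2 n \<ge> n" and p: "\<And>n. 0 \<le> p n \<and> p n \<le> 1"
    and left: "little_o (\<lambda>n. sqrt (real n * p n) * (ln (real n)) ^ 3) (\<lambda>n. real n * p n)"
    and right: "little_o (\<lambda>n. sqrt (real (n2 n) * p n) * (ln (real (n2 n))) ^ 3)
      (\<lambda>n. real (n2 n) * p n)"
  shows "\<forall>\<^sub>F n in sequentially. dense_random_bipartite n (n2 n) (p n)"
proof -
  have "filterlim (\<lambda>n. ln (real n)) at_top sequentially"
    by (rule filterlim_compose[OF ln_at_top filterlim_real_sequentially])
  hence "\<forall>\<^sub>F n in sequentially. ln (real n) \<ge> 4800" by (simp add: filterlim_at_top)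
  moreover have "\<forall>\<^sub>F n in sequentially. n \<ge> (2 :: nat)" by (rule eventually_ge_at_top)
  ultimately show ?thesis
    using eventually_le_sqrt_of_little_o[OF left] eventually_le_sqrt_of_little_o[OF right]
  proof eventually_elim
    case (elim n)
    let ?l1 = "ln (real n)" and ?l2 = "ln (real (n2 n))"
    have "?l1 \<le> ?l2" using elim n2[of n] by (intro ln_mono) auto
    hence l2: "?l2 \<ge> 4800" using elim by linarith
    have "12 * (20 * ?l2)\<^sup>2 = 4800 * ?l2\<^sup>2" by (simp add: power_mult_distrib)
    also have "\<dots> \<le> ?l2 * ?l2\<^sup>2" using l2 by (intro mult_right_mono) auto
    also have "\<dots> = ?l2 ^ 3" by (simp add: eval_nat_numeral)
    finally have right: "12 * (20 * ?l2)\<^sup>2 \<le> sqrt (real (n2 n) * p n)" using elim by linarith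
    have "128 * ?l1 \<le> ?l1 * ?l1" using elim by (intro mult_right_mono) auto
    also have "\<dots> = ?l1 ^ 2" by (simp add: power2_eq_square)
    also have "\<dots> \<le> ?l1 ^ 6" using elim by (intro power_increasing) auto
    also have "\<dots> = (?l1 ^ 3)\<^sup>2" by simp
    also have "\<dots> \<le> (sqrt (real n * p n))\<^sup>2" using elim by (intro power_mono) auto
    finally have left: "128 * ?l1 \<le> real n * p n" using elim by simp
    have "p n > 0" using elim by (simp add: zero_less_mult_iff)
    thus ?case using elim left right n2 p by unfold_locales auto
  qed
qed

lemma tendsto_1_of_ge_1_minus_over:
  fixes q :: "nat \<Rightarrow> real"
  assumes "\<forall>\<^sub>F n in sequentially. 1 - c / real n \<le> q n" "\<And>n. q n \<le> 1"
  shows "q \<longlonglongrightarrow> 1"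
proof (rule tendsto_sandwich[OF assms(1)])
  show "(\<lambda>n. 1 - c / real n) \<longlonglongrightarrow> 1"
    using tendsto_diff[OF tendsto_const lim_const_over_n[of c], of 1] by simp
qed (use assms(2) in auto)

theorem theoremA:
  fixes n2 :: "nat \<Rightarrow> nat" and p :: "nat \<Rightarrow> real"
  assumes "\<And>n1. n2 n1 \<ge> n1"
    and "\<And>n1. 0 \<le> p n1 \<and> p n1 \<le> 1"
    and "little_o (\<lambda>n1. sqrt (real n1 * p n1) * (ln (real n1)) ^ 3) (\<lambda>n1. real n1 * p n1)"
    and "little_o (\<lambda>n1. sqrt (real (n2 n1) * p n1) * (ln (real (n2 n1))) ^ 3)
           (\<lambda>n1. real (n2 n1) * p n1)"
  shows "(\<exists>\<epsilon> :: nat \<Rightarrow> real. \<epsilon> \<longlonglongrightarrow> 0 \<and>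
            (\<lambda>n1. measure_pmf.prob (random_bipartite n1 (n2 n1) (p n1))
               {E. mu 2 (adjacency_matrix (n1 + n2 n1) E)
                   \<le> 2 * (1 + \<epsilon> n1) *
                      (sqrt (real (n1 + n2 n1) * p n1) + sqrt (real n1 * p n1)
                       + sqrt (real (n2 n1) * p n1))}) \<longlonglongrightarrow> 1)
       \<and> (\<exists>\<epsilon>' :: nat \<Rightarrow> real. \<epsilon>' \<longlonglongrightarrow> 0 \<and>
            (\<lambda>n1. measure_pmf.prob (random_bipartite n1 (n2 n1) (p n1))
               {E. Max ((\<lambda>i. \<bar>mu_graph i (n1 + n2 n1) E - 1\<bar>) ` ({1..n1 + n2 n1} - {1, n1 + n2 n1}))
                   \<le> 2 * (1 + \<epsilon>' n1) *
                      (sqrt (1 / (real n1 * p n1) + 1 / (real (n2 n1) * p n1))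
                       + 1 / sqrt (real n1 * p n1) + 1 / sqrt (real (n2 n1) * p n1))}) \<longlonglongrightarrow> 1)"
    (is "(\<exists>\<epsilon>. _ \<and> ?adjacency \<epsilon> \<longlonglongrightarrow> 1) \<and> (\<exists>\<epsilon>'. _ \<and> ?laplacian \<epsilon>' \<longlonglongrightarrow> 1)")
proof -
  have dense: "\<forall>\<^sub>F n1 in sequentially. dense_random_bipartite n1 (n2 n1) (p n1)"
    by (rule eventually_dense_random_bipartite[OF assms])
  have "?adjacency (\<lambda>_. 0) \<longlonglongrightarrow> 1"
  proof (rule tendsto_1_of_ge_1_minus_over)
    show "\<forall>\<^sub>F n1 in sequentially. 1 - 1 / real n1 \<le> ?adjacency (\<lambda>_. 0) n1"
      using dense unfolding add_0_right mult_1_right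
      by eventually_elim (rule dense_random_bipartite.prob_mu_adjacency_ge)
  qed simp
  moreover have "?laplacian (\<lambda>_. 0) \<longlonglongrightarrow> 1"
  proof (rule tendsto_1_of_ge_1_minus_over)
    show "\<forall>\<^sub>F n1 in sequentially. 1 - 3 / real n1 \<le> ?laplacian (\<lambda>_. 0) n1"
      using dense unfolding add_0_right mult_1_right laplacian_deviation_def[symmetric]
      by eventually_elim (rule dense_random_bipartite.prob_laplacian_deviation_ge)
  qed simp
  ultimately show ?thesis by (intro conjI exI[of _ "\<lambda>_. 0"]) auto
qed

end
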